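(* The noncommutative variational Schouten bracket is shifted-graded skew-symmetric: $$[\![F,G]\!]=-(-1)^{(|F|-1)\cdot(|G|-1)}[\![G,F]\!]$$ for any homogeneous local functionals $F$ and $G$ over the infinite jet superspace.
   Context: **Letters and cyclic words.** The ground field is $\mathbb{R}$. $M^n$ is an oriented affine real manifold of dimension $n$, with local affine coordinates $x=(x^1,\dots,x^n)$ and a volume element $\mathrm{dvol}(x)$. The alphabet consists of even letters $a^i_\sigma$ (degree $0$) and odd letters $b_{j,\tau}$ (degree $1$), $1\le i,j\le m$, where $\sigma,\tau$ are multi-indices ($a^i=a^i_\varnothing$, $b_j=b_{j,\varnothing}$); $[a],[b]$ denote dependence on finitely many of these jet letters. The degree $|w|$ of a word is the number of its odd letters. A cyclic word $(w)$ is the class of an element $w$ of the free associative algebra on these letters (with coefficients in $C^\infty(M^n)$) modulo the linear relation $w\sim\mathfrak{t}(w)$, $\mathfrak{t}(\gamma_1\cdots\gamma_\lambda)=(-1)^{|\gamma_1\cdots\gamma_{\lambda-1}|\cdot|\gamma_\lambda|}\gamma_\lambda\gamma_1\cdots\gamma_{\lambda-1}$. For words of lengths $\lambda(w_1),\lambda(w_2)>0$ put $$(w_1)\times(w_2)=\frac{1}{\lambda(w_1)\lambda(w_2)}\sum_{i=1}^{\lambda(w_1)}\sum_{j=1}^{\lambda(w_2)}\bigl(\mathfrak{t}^{i-1}(w_1)\,\mathfrak{t}^{j-1}(w_2)\bigr),$$ extended bilinearly, zero-length words being scalars acting by multiplication. This product is graded commutative and not associative. The total derivative $D_{x^k}$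 is the derivation equal to $\partial/\partial x^k$ on coefficients with $a^i_\sigma\mapsto a^i_{\sigma\cup\{k\}}$, $b_{j,\tau}\mapsto b_{j,\tau\cup\{k\}}$. **Functionals.** An integral functional is $F=\int f(x,[a],[b])\,\mathrm{dvol}(x)$ with $f$ a (sum of) cyclic word(s), modulo integration by parts without boundary terms (coefficients are smooth and, if $M^n$ is not closed, decay rapidly towards the boundary or infinity). The product of $F_1,F_2$ is $F_1\times F_2=\iint f_1|_{x_1}\times f_2|_{x_2}\,\mathrm{dvol}(x_1)\mathrm{dvol}(x_2)$ over $M^n\times M^n$. Local functionals are linear combinations of products of $\ell\ge0$ integral functionals (with a specified bracketing; default $(\cdots(F_1\times F_2)\times\cdots)\times F_\ell$). Each letter in such a product remembers the factor $F_\alpha$, and the copy of $M^n$, from which it comes; the total derivatives $D^{(\alpha)}$ over the $\alpha$-th copy act only on the letters and coefficients of the $\alpha$-th factor. **Derivatives.** $\overrightarrow\partial/\partial b_{i,\tau}$ acts on a cyclic word by deletion without changing the cyclic order of the remaining letters: $(c_1\cdots c_\lambda)\mapsto\sum_{\nu:\,c_\nu=b_{i,\tau}}(-1)^{|c_1\cdots c_{\nu-1}|}(c_1\cdots c_{\nu-1}c_{\nu+1}\cdots c_\lambda)$; similarly (without signs) for $\partial/\partial a^i_\sigma$. The right-acting derivative is $(w)\overleftarrow\partial/\partial b_{i,\tau}=(-1)^{|w|-1}\overrightarrow\partial w/\partial b_{i,\tau}$. **BV Laplacian.** For an integral functional, $\Delta F=\int\sum_i\sum_{\sigma,\tau}(-D)^{\sigma\cup\tau}\frac{\overrightarrow\partial^2f}{\partial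 a^i_\sigma\,\partial b_{i,\tau}}\,\mathrm{dvol}(x)$. On a product with density word $h$, $\Delta$ acts by $\sum_{\alpha,\beta}\sum_i\sum_{\sigma,\tau}(-D^{(\alpha)})^\sigma(-D^{(\beta)})^\tau\frac{\overrightarrow\partial^{(\alpha)}}{\partial a^i_\sigma}\frac{\overrightarrow\partial^{(\beta)}}{\partial b_{i,\tau}}h$, where the superscripts say from which factor the deleted letter is taken and, for $\alpha\ne\beta$, the copies $\alpha,\beta$ of $M^n$ are identified along the diagonal $x_\alpha=x_\beta$. The product word is always formed first; then the derivatives act on its letters. **Schouten bracket.** For $F$ homogeneous, the bracket $[\![\,,]\!]$ is defined by $\Delta(F\times G)=\Delta F\times G+(-1)^{|F|}[\![F,G]\!]+(-1)^{|F|}F\times\Delta G$. Here $\Delta F\times G$ and $F\times\Delta G$ are the parts of $\Delta(F\times G)$ in which both deleted letters come from $F$, resp. from $G$. Explicitly, for integral functionals, $[\![F,G]\!]=\int\sum\bigl\{(f)\frac{\overleftarrow\partial}{\partial a^i_\sigma}(-\overleftarrow D)^\sigma\times(-\overrightarrow D)^\tau\frac{\overrightarrow\partial}{\partial b_{i,\tau}}(g)-(f)\frac{\overleftarrow\partial}{\partial b_{i,\sigma}}(-\overleftarrow D)^\sigma\times(-\overrightarrow D)^\tau\frac{\overrightarrow\partial}{\partial a^i_\tau}(g)\bigr\}\mathrm{dvol}(x)$, where the product word $f\times g$ is formed first and the derivatives then act on the letters of the respective factor. *)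

theory Defs
  imports
    "HOL-Analysis.Analysis"
    "HOL-Library.Poly_Mapping"
    "HOL-Library.Function_Algebras"
    "HOL-Library.Multiset"
    "HOL-Combinatorics.Permutations"
begin

section \<open>Oriented affine manifolds with a volume element\<close>

text \<open>
  The manifold is the type \<^typ>\<open>'x\<close>, with an affine atlas indexed by \<^typ>\<open>'c\<close>. A function given in
  local coordinates is a function of pairs \<open>(c, x)\<close> of a chart and a point of its domain, so that
  partial derivatives along the coordinate axes are defined; chart independence is imposed on
  densities below. The component \<open>volume\<close> is the density of dvol with respect to the Lebesgue measure
  of each chart. The component \<open>gauge\<close> is an exhaustion function, relevant for noncompact manifolds
  only: rapid decay is decay faster than every power of it, e.g. the Schwartz condition for
  \<open>gauge x = norm x\<close> on a Euclidean space, and flatness at the boundary if \<open>gauge\<close> is the inverse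
  distance from it.
\<close>

record ('c, 'x, 'n) mfd =
  chart_dom :: "'c \<Rightarrow> 'x set"
  chart :: "'c \<Rightarrow> 'x \<Rightarrow> real ^ 'n"
  volume :: "'c \<times> 'x \<Rightarrow> real"
  gauge :: "'x \<Rightarrow> real"

abbreviation chart_inv :: "('c, 'x, 'n::finite) mfd \<Rightarrow> 'c \<Rightarrow> real ^ 'n \<Rightarrow> 'x" where
  "chart_inv M c \<equiv> inv_into (chart_dom M c) (chart M c)"

definition local_pts :: "('c, 'x, 'n::finite) mfd \<Rightarrow> ('c \<times> 'x) set" where
  "local_pts M = {(c, x). x \<in> chart_dom M c}"

definition step :: "('c, 'x, 'n::finite) mfd \<Rightarrow> 'n \<Rightarrow> real \<Rightarrow> 'c \<times> 'x \<Rightarrow> 'c \<times> 'x" where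
  "step M k t = (\<lambda>(c, x). (c, chart_inv M c (chart M c x + t *\<^sub>R axis k 1)))"

definition pd :: "('c, 'x, 'n::finite) mfd \<Rightarrow> 'n \<Rightarrow> ('c \<times> 'x \<Rightarrow> real) \<Rightarrow> 'c \<times> 'x \<Rightarrow> real" where
  "pd M k f u = deriv (\<lambda>t. f (step M k t u)) 0"

definition smooth :: "('c, 'x::topological_space, 'n::finite) mfd \<Rightarrow> ('c \<times> 'x \<Rightarrow> real) \<Rightarrow> bool" where
  "smooth M f \<longleftrightarrow> (\<forall>ks c. let h = fold (pd M) ks f in
     continuous_on (chart_dom M c) (\<lambda>x. h (c, x)) \<and>
     (\<forall>x\<in>chart_dom M c. \<forall>k. (\<lambda>t. h (step M k t (c, x))) field_differentiable at 0))"

text \<open>The entry \<open>(i, j)\<close> of \<open>jac M c c' x\<close> is \<open>\<partial>y\<^sup>i/\<partial>x\<^sup>j\<close> for the coordinates \<open>x\<close> of the chart \<open>c\<close>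
  and \<open>y\<close> of the chart \<open>c'\<close>.\<close>

definition jac :: "('c, 'x, 'n::finite) mfd \<Rightarrow> 'c \<Rightarrow> 'c \<Rightarrow> 'x \<Rightarrow> real ^ 'n ^ 'n" where
  "jac M c c' x =
     matrix (frechet_derivative (\<lambda>v. chart M c' (chart_inv M c v)) (at (chart M c x)))"

definition affine_manifold ::
  "('c, 'x::{t2_space, second_countable_topology}, 'n::finite) mfd \<Rightarrow> bool" where
  "affine_manifold M \<longleftrightarrow>
     (\<Union>c. chart_dom M c) = UNIV \<and>
     (\<forall>c. open (chart_dom M c) \<and> open (chart M c ` chart_dom M c) \<and>
        homeomorphism (chart_dom M c) (chart M c ` chart_dom M c) (chart M c) (chart_inv M c)) \<and>
     (\<forall>c c'. \<forall>x \<in> chart_dom M c \<inter> chart_dom M c'.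
        \<exists>(A :: real ^ 'n ^ 'n) b N. det A > 0 \<and>
          open N \<and> x \<in> N \<and> N \<subseteq> chart_dom M c \<inter> chart_dom M c' \<and>
          (\<forall>y\<in>N. chart M c' y = A *v chart M c y + b)) \<and>
     smooth M (volume M) \<and>
     (\<forall>u\<in>local_pts M. volume M u > 0) \<and>
     (\<forall>c c'. \<forall>x \<in> chart_dom M c \<inter> chart_dom M c'.
        volume M (c, x) = volume M (c', x) * det (jac M c c' x)) \<and>
     (\<not> compact (UNIV :: 'x set) \<longrightarrow>
        continuous_on UNIV (gauge M) \<and> (\<forall>r. compact {x. gauge M x \<le> r}))"

definition admissible_coeffs ::
  "('c, 'x::topological_space, 'n::finite) mfd \<Rightarrow> ('c \<times> 'x \<Rightarrow> real) set" where
  "admissible_coeffs M = {f. smooth M f \<and>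
     (\<not> compact (UNIV :: 'x set) \<longrightarrow>
        (\<forall>ks N. \<exists>C. \<forall>u\<in>local_pts M. \<bar>gauge M (snd u)\<bar> ^ N * \<bar>fold (pd M) ks f u\<bar> \<le> C))}"


section \<open>Letters and cyclic words\<close>

text \<open>\<open>Ev i \<sigma>\<close> is \<open>a\<^sup>i\<^sub>\<sigma>\<close> and \<open>Od j \<tau>\<close> is \<open>b\<^sub>j\<^sub>,\<^sub>\<tau>\<close>. Multi-indices are multisets of directions. In a word,
  each letter carries the number of the factor (equivalently, of the copy of the manifold) it
  comes from. Finitely supported maps from words to the reals form the free associative algebra.\<close>

datatype ('m, 'n) letter =
  is_Ev: Ev (letter_index: 'm) (jet: "'n multiset")
| is_Od: Od (letter_index: 'm) (jet: "'n multiset")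

primrec set_jet :: "'n multiset \<Rightarrow> ('m, 'n) letter \<Rightarrow> ('m, 'n) letter" where
  "set_jet \<sigma> (Ev i _) = Ev i \<sigma>"
| "set_jet \<sigma> (Od j _) = Od j \<sigma>"

type_synonym ('m, 'n) word = "(nat \<times> ('m, 'n) letter) list"
type_synonym ('m, 'n) ncpoly = "('m, 'n) word \<Rightarrow>\<^sub>0 real"

definition wdeg :: "('m, 'n) word \<Rightarrow> nat" where
  "wdeg w = length (filter (\<lambda>(\<alpha>, l). is_Od l) w)"

abbreviation mono :: "('m, 'n) word \<Rightarrow> ('m, 'n) ncpoly" where
  "mono w \<equiv> Poly_Mapping.single w 1"

definition scl :: "real \<Rightarrow> ('m, 'n) ncpoly \<Rightarrow> ('m, 'n) ncpoly" where
  "scl r h = Poly_Mapping.map ((*) r) h"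

definition lin_ext :: "(('m, 'n) word \<Rightarrow> ('m, 'n) ncpoly) \<Rightarrow> ('m, 'n) ncpoly \<Rightarrow> ('m, 'n) ncpoly" where
  "lin_ext T h = (\<Sum>w\<in>Poly_Mapping.keys h. scl (Poly_Mapping.lookup h w) (T w))"

definition bilin_ext ::
  "(('m, 'n) word \<Rightarrow> ('m, 'n) word \<Rightarrow> ('m, 'n) ncpoly) \<Rightarrow>
   ('m, 'n) ncpoly \<Rightarrow> ('m, 'n) ncpoly \<Rightarrow> ('m, 'n) ncpoly" where
  "bilin_ext B f g = lin_ext (\<lambda>u. lin_ext (\<lambda>v. B u v) g) f"

definition nc_mult :: "('m, 'n) ncpoly \<Rightarrow> ('m, 'n) ncpoly \<Rightarrow> ('m, 'n) ncpoly" where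
  "nc_mult = bilin_ext (\<lambda>u v. mono (u @ v))"

definition rot_word :: "('m, 'n) word \<Rightarrow> ('m, 'n) ncpoly" where
  "rot_word w = (if w = [] then mono []
     else Poly_Mapping.single (last w # butlast w) ((-1) ^ (wdeg (butlast w) * wdeg [last w])))"

definition rot :: "('m, 'n) ncpoly \<Rightarrow> ('m, 'n) ncpoly" where
  "rot = lin_ext rot_word"

text \<open>Cyclic words are elements of the free algebra modulo the following subspace.\<close>

definition cyc_null :: "('m, 'n) ncpoly set" where
  "cyc_null = range (\<lambda>g. g - rot g)"

definition word_times :: "('m, 'n) word \<Rightarrow> ('m, 'n) word \<Rightarrow> ('m, 'n) ncpoly" where
  "word_times u v = (if u = [] \<or> v = [] then mono (u @ v)
     else scl (1 / (real (length u) * real (length v)))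
       (\<Sum>i<length u. \<Sum>j<length v. nc_mult ((rot ^^ i) (mono u)) ((rot ^^ j) (mono v))))"

definition cyc_times :: "('m, 'n) ncpoly \<Rightarrow> ('m, 'n) ncpoly \<Rightarrow> ('m, 'n) ncpoly" where
  "cyc_times = bilin_ext word_times"

definition del_letter :: "nat \<times> ('m, 'n) letter \<Rightarrow> ('m, 'n) word \<Rightarrow> ('m, 'n) ncpoly" where
  "del_letter l w = (\<Sum>\<nu> | \<nu> < length w \<and> w ! \<nu> = l.
     Poly_Mapping.single (take \<nu> w @ drop (Suc \<nu>) w) ((-1) ^ (wdeg [l] * wdeg (take \<nu> w))))"

definition shift_jet :: "nat \<Rightarrow> 'n \<Rightarrow> ('m, 'n) word \<Rightarrow> ('m, 'n) ncpoly" where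
  "shift_jet \<alpha> k w = (\<Sum>\<nu> | \<nu> < length w \<and> fst (w ! \<nu>) = \<alpha>.
     mono (w[\<nu> := (\<alpha>, set_jet (add_mset k (jet (snd (w ! \<nu>)))) (snd (w ! \<nu>)))]))"


section \<open>Densities over several copies of the manifold\<close>

text \<open>
  A density over \<open>L\<close> copies assigns to the points \<open>p 0, \<dots>, p (L - 1)\<close> of the copies, each with a chart
  around it, an element of the free algebra; the entries \<open>p i\<close> with \<open>i \<ge> L\<close> are irrelevant.
\<close>

type_synonym ('c, 'x) config = "nat \<Rightarrow> 'c \<times> 'x"
type_synonym ('c, 'x, 'm, 'n) dens = "('c, 'x) config \<Rightarrow> ('m, 'n) ncpoly"

definition configs :: "('c, 'x, 'n::finite) mfd \<Rightarrow> ('c, 'x) config set" where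
  "configs M = {p. \<forall>i. p i \<in> local_pts M}"

text \<open>The total derivative \<open>D\<^sub>k\<close> over the copy \<open>\<alpha>\<close>, and \<open>(-D)\<^sup>\<sigma>\<close>. For smooth coefficients the total
  derivatives commute, so the chosen enumeration of \<open>\<sigma>\<close> is immaterial.\<close>

definition total_d ::
  "('c, 'x, 'n::finite) mfd \<Rightarrow> nat \<Rightarrow> 'n \<Rightarrow> ('c, 'x, 'm, 'n) dens \<Rightarrow> ('c, 'x, 'm, 'n) dens" where
  "total_d M \<alpha> k h p =
     (\<Sum>w. Poly_Mapping.single w
        (deriv (\<lambda>t. Poly_Mapping.lookup (h (p(\<alpha> := step M k t (p \<alpha>)))) w) 0))
     + lin_ext (shift_jet \<alpha> k) (h p)"

definition minus_d_pow ::
  "('c, 'x, 'n::finite) mfd \<Rightarrow> nat \<Rightarrow> 'n multiset \<Rightarrow> ('c, 'x, 'm, 'n) dens \<Rightarrow> ('c, 'x, 'm, 'n) dens"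
  where
  "minus_d_pow M \<alpha> \<sigma> = fold (\<lambda>k h. - total_d M \<alpha> k h) (SOME ks. mset ks = \<sigma>)"

text \<open>\<open>relabel r\<close> renames the copies along \<open>r\<close>; a noninjective \<open>r\<close> restricts to a diagonal.\<close>

definition relabel :: "(nat \<Rightarrow> nat) \<Rightarrow> ('c, 'x, 'm, 'n) dens \<Rightarrow> ('c, 'x, 'm, 'n) dens" where
  "relabel r h p = lin_ext (\<lambda>w. mono (map (map_prod r id) w)) (h (p \<circ> r))"

text \<open>The copy \<open>\<beta>\<close> is identified with \<open>\<alpha>\<close> and the remaining copies are renumbered consecutively.\<close>

definition merge :: "nat \<Rightarrow> nat \<Rightarrow> nat \<Rightarrow> nat" where
  "merge \<alpha> \<beta> \<gamma> = (let \<delta> = if \<gamma> = \<beta> then \<alpha> else \<gamma> in if \<delta> > \<beta> then \<delta> - 1 else \<delta>)"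

text \<open>Change of charts: with \<open>x\<close> the coordinates of the chart in \<open>p\<close> and \<open>y\<close> those in \<open>p'\<close>, the letter
  with jet index \<open>k\<^sub>1 \<dots> k\<^sub>r\<close> in the coordinates \<open>y\<close> is the sum over \<open>j\<^sub>1 \<dots> j\<^sub>r\<close> of
  \<open>\<Prod>\<^sub>s \<partial>x\<^bsup>j\<^sub>s\<^esup>/\<partial>y\<^bsup>k\<^sub>s\<^esup>\<close> times the letter with jet index \<open>j\<^sub>1 \<dots> j\<^sub>r\<close> in the coordinates \<open>x\<close>.\<close>

definition letter_change ::
  "('c, 'x, 'n::finite) mfd \<Rightarrow> ('c, 'x) config \<Rightarrow> ('c, 'x) config \<Rightarrow> nat \<times> ('m, 'n) letter \<Rightarrow>
   ('m, 'n) ncpoly" where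
  "letter_change M p' p l =
     (let \<alpha> = fst l; ks = (SOME ks. mset ks = jet (snd l));
          J = jac M (fst (p' \<alpha>)) (fst (p \<alpha>)) (snd (p \<alpha>))
      in \<Sum>js | length js = length ks.
           Poly_Mapping.single [(\<alpha>, set_jet (mset js) (snd l))]
             (\<Prod>s<length ks. J $ (js ! s) $ (ks ! s)))"

primrec word_change ::
  "('c, 'x, 'n::finite) mfd \<Rightarrow> ('c, 'x) config \<Rightarrow> ('c, 'x) config \<Rightarrow> ('m, 'n) word \<Rightarrow>
   ('m, 'n) ncpoly" where
  "word_change M p' p [] = mono []"
| "word_change M p' p (l # w) = nc_mult (letter_change M p' p l) (word_change M p' p w)"

definition same_base :: "('c, 'x) config \<Rightarrow> ('c, 'x) config \<Rightarrow> bool" where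
  "same_base p p' \<longleftrightarrow> (\<forall>i. snd (p i) = snd (p' i))"

text \<open>Coefficients over \<open>L\<close> copies: the \<open>L\<close>-th tensor power of the coefficient algebra.\<close>

definition multi_coeffs ::
  "('c, 'x::topological_space, 'n::finite) mfd \<Rightarrow> nat \<Rightarrow> (('c, 'x) config \<Rightarrow> real) set" where
  "multi_coeffs M L = {f. \<exists>N r e. (\<forall>s<N. \<forall>i<L. e s i \<in> admissible_coeffs M) \<and>
     f = (\<lambda>p. \<Sum>s<(N::nat). r s * (\<Prod>i<L. e s i (p i)))}"

definition pre_density ::
  "('c, 'x::topological_space, 'n::finite) mfd \<Rightarrow> nat \<Rightarrow> ('c, 'x, 'm, 'n) dens \<Rightarrow> bool" where
  "pre_density M L h \<longleftrightarrow>
     (\<exists>W. finite W \<and> (\<forall>w\<in>W. \<forall>l\<in>set w. fst l < L) \<and> (\<forall>p. Poly_Mapping.keys (h p) \<subseteq> W)) \<and>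
     (\<forall>w. (\<lambda>p. Poly_Mapping.lookup (h p) w) \<in> multi_coeffs M L)"

definition density ::
  "('c, 'x::topological_space, 'n::finite) mfd \<Rightarrow> nat \<Rightarrow> ('c, 'x, 'm, 'n) dens \<Rightarrow> bool" where
  "density M L h \<longleftrightarrow> pre_density M L h \<and>
     (\<forall>p\<in>configs M. \<forall>p'\<in>configs M. same_base p p' \<longrightarrow>
        lin_ext (word_change M p' p) (h p') = h p)"

text \<open>The components of a horizontal vector field over the copy \<open>\<alpha>\<close>, and its divergence with respect
  to the volume element; integration by parts without boundary terms annihilates the latter. If
  the volume element is constant in the affine charts, the divergence is the sum of \<open>D\<^sub>k (g k)\<close>.\<close>

definition vector_density ::
  "('c, 'x::topological_space, 'n::finite) mfd \<Rightarrow> nat \<Rightarrow> nat \<Rightarrow> ('n \<Rightarrow> ('c, 'x, 'm, 'n) dens) \<Rightarrow> bool"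
  where
  "vector_density M L \<alpha> g \<longleftrightarrow> (\<forall>k. pre_density M L (g k)) \<and>
     (\<forall>p\<in>configs M. \<forall>p'\<in>configs M. same_base p p' \<longrightarrow>
        (\<forall>k. lin_ext (word_change M p' p) (g k p') =
           (\<Sum>j\<in>UNIV. scl (jac M (fst (p \<alpha>)) (fst (p' \<alpha>)) (snd (p \<alpha>)) $ k $ j) (g j p))))"

definition divergence ::
  "('c, 'x, 'n::finite) mfd \<Rightarrow> nat \<Rightarrow> ('n \<Rightarrow> ('c, 'x, 'm, 'n) dens) \<Rightarrow> ('c, 'x, 'm, 'n) dens" where
  "divergence M \<alpha> g p = scl (1 / volume M (p \<alpha>))
     (\<Sum>k\<in>UNIV. total_d M \<alpha> k (\<lambda>q. scl (volume M (q \<alpha>)) (g k q)) p)"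


section \<open>Functionals\<close>

text \<open>A functional is represented by the family \<open>F\<close> of its densities, \<open>F L\<close> being integrated over
  \<open>L\<close> copies of the manifold.\<close>

type_synonym ('c, 'x, 'm, 'n) functional = "nat \<Rightarrow> ('c, 'x, 'm, 'n) dens"

definition over :: "nat \<Rightarrow> ('c, 'x, 'm, 'n) dens \<Rightarrow> ('c, 'x, 'm, 'n) functional" where
  "over L h = (\<lambda>j. if j = L then h else 0)"

definition fscl :: "real \<Rightarrow> ('c, 'x, 'm, 'n) functional \<Rightarrow> ('c, 'x, 'm, 'n) functional" where
  "fscl r F = (\<lambda>L p. scl r (F L p))"

text \<open>The product of densities over \<open>k\<close> and \<open>l\<close> copies lives over \<open>k + l\<close> copies.\<close>

definition dens_times ::
  "nat \<Rightarrow> ('c, 'x, 'm, 'n) dens \<Rightarrow> ('c, 'x, 'm, 'n) dens \<Rightarrow> ('c, 'x, 'm, 'n) dens" where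
  "dens_times k f g p = cyc_times (f p) (relabel (\<lambda>\<gamma>. \<gamma> + k) g p)"

definition ftimes ::
  "('c, 'x, 'm, 'n) functional \<Rightarrow> ('c, 'x, 'm, 'n) functional \<Rightarrow> ('c, 'x, 'm, 'n) functional" where
  "ftimes F G = (\<lambda>L. \<Sum>k\<le>L. dens_times k (F k) (G (L - k)))"

inductive_set local_functionals ::
  "('c, 'x::topological_space, 'n::finite) mfd \<Rightarrow> ('c, 'x, 'm, 'n) functional set"
  for M :: "('c, 'x, 'n) mfd" where
  number: "over 0 (\<lambda>p. Poly_Mapping.single [] r) \<in> local_functionals M"
| integral: "density M 1 f \<Longrightarrow> over 1 f \<in> local_functionals M"
| times: "F \<in> local_functionals M \<Longrightarrow> G \<in> local_functionals M \<Longrightarrow> ftimes F G \<in> local_functionals M"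
| plus: "F \<in> local_functionals M \<Longrightarrow> G \<in> local_functionals M \<Longrightarrow> F + G \<in> local_functionals M"
| scale: "F \<in> local_functionals M \<Longrightarrow> fscl r F \<in> local_functionals M"

definition homogeneous :: "nat \<Rightarrow> ('c, 'x, 'm, 'n) functional \<Rightarrow> bool" where
  "homogeneous d F \<longleftrightarrow> (\<forall>L p. \<forall>w\<in>Poly_Mapping.keys (F L p). wdeg w = d)"

text \<open>The degree is arbitrary for \<open>F = 0\<close>, which is homogeneous of every degree.\<close>

definition fdeg :: "('c, 'x, 'm, 'n) functional \<Rightarrow> nat" where
  "fdeg F = (SOME d. homogeneous d F)"

text \<open>
  Representatives define the same functional if they differ by cyclic permutations of words, by the
  names of the integration variables, and by integration by parts over one of the copies.
  In the first two clauses no regularity is required: if an element \<open>h\<close> of the span is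
  a density, averaging over all permutations of the copies shows that regular summands suffice.
\<close>

inductive_set null_functionals ::
  "('c, 'x::topological_space, 'n::finite) mfd \<Rightarrow> ('c, 'x, 'm, 'n) functional set"
  for M :: "('c, 'x, 'n) mfd" where
  cyclic: "(\<And>L p. p \<in> configs M \<Longrightarrow> H L p \<in> cyc_null) \<Longrightarrow> H \<in> null_functionals M"
| rename: "\<pi> permutes {..<L} \<Longrightarrow> over L (h - relabel \<pi> h) \<in> null_functionals M"
| by_parts: "\<alpha> < L \<Longrightarrow> vector_density M L \<alpha> g \<Longrightarrow> over L (divergence M \<alpha> g) \<in> null_functionals M"
| plus: "H \<in> null_functionals M \<Longrightarrow> H' \<in> null_functionals M \<Longrightarrow> H + H' \<in> null_functionals M"

definition feq ::
  "('c, 'x::topological_space, 'n::finite) mfd \<Rightarrow>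
   ('c, 'x, 'm, 'n) functional \<Rightarrow> ('c, 'x, 'm, 'n) functional \<Rightarrow> bool" where
  "feq M F G \<longleftrightarrow> F - G \<in> null_functionals M"


section \<open>The BV Laplacian and the Schouten bracket\<close>

text \<open>The summand in which the even letter is taken from the factor \<open>\<alpha>\<close> and the odd one from \<open>\<beta>\<close>,
  before restriction to the diagonal. The sum over all multi-indices has finite support.\<close>

definition laplace_term ::
  "('c, 'x, 'n::finite) mfd \<Rightarrow> nat \<Rightarrow> nat \<Rightarrow> ('c, 'x, 'm::finite, 'n) dens \<Rightarrow> ('c, 'x, 'm, 'n) dens"
  where
  "laplace_term M \<alpha> \<beta> h p = (\<Sum>i\<in>UNIV. \<Sum>(\<sigma>, \<tau>).
     minus_d_pow M \<alpha> \<sigma> (minus_d_pow M \<beta> \<tau>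
       (\<lambda>q. lin_ext (del_letter (\<alpha>, Ev i \<sigma>)) (lin_ext (del_letter (\<beta>, Od i \<tau>)) (h q)))) p)"

definition laplace_on ::
  "('c, 'x, 'n::finite) mfd \<Rightarrow> (nat \<times> nat) set \<Rightarrow> nat \<Rightarrow> ('c, 'x, 'm::finite, 'n) dens \<Rightarrow>
   ('c, 'x, 'm, 'n) functional" where
  "laplace_on M S L h = (\<Sum>(\<alpha>, \<beta>)\<in>S.
     if \<alpha> = \<beta> then over L (laplace_term M \<alpha> \<beta> h)
     else over (L - 1) (relabel (merge \<alpha> \<beta>) (laplace_term M \<alpha> \<beta> h)))"

text \<open>Only the components of \<open>F\<close> over \<open>j\<close> and \<open>j + 1\<close> copies contribute over \<open>j\<close> copies.\<close>

definition laplace ::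
  "('c, 'x, 'n::finite) mfd \<Rightarrow> ('c, 'x, 'm::finite, 'n) functional \<Rightarrow> ('c, 'x, 'm, 'n) functional"
  where
  "laplace M F = (\<lambda>j. \<Sum>L\<le>Suc j. laplace_on M ({..<L} \<times> {..<L}) L (F L) j)"

text \<open>The parts of \<open>laplace M (ftimes F G)\<close> in which both letters come from \<open>F\<close>, resp. from \<open>G\<close>.\<close>

definition laplace_left ::
  "('c, 'x, 'n::finite) mfd \<Rightarrow> ('c, 'x, 'm::finite, 'n) functional \<Rightarrow> ('c, 'x, 'm, 'n) functional \<Rightarrow>
   ('c, 'x, 'm, 'n) functional" where
  "laplace_left M F G = (\<lambda>j. \<Sum>k\<le>Suc j. \<Sum>l\<le>Suc j.
     laplace_on M ({..<k} \<times> {..<k}) (k + l) (dens_times k (F k) (G l)) j)"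

definition laplace_right ::
  "('c, 'x, 'n::finite) mfd \<Rightarrow> ('c, 'x, 'm::finite, 'n) functional \<Rightarrow> ('c, 'x, 'm, 'n) functional \<Rightarrow>
   ('c, 'x, 'm, 'n) functional" where
  "laplace_right M F G = (\<lambda>j. \<Sum>k\<le>Suc j. \<Sum>l\<le>Suc j.
     laplace_on M ({k..<k + l} \<times> {k..<k + l}) (k + l) (dens_times k (F k) (G l)) j)"

text \<open>The signed term \<open>(-1)\<^bsup>|F|\<^esup> F \<times> \<Delta>G\<close> of the defining identity is \<open>laplace_right M F G\<close>: its sign
  arises when the odd derivative passes the letters of \<open>F\<close>.\<close>

definition schouten ::
  "('c, 'x, 'n::finite) mfd \<Rightarrow> ('c, 'x, 'm::finite, 'n) functional \<Rightarrow> ('c, 'x, 'm, 'n) functional \<Rightarrow>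
   ('c, 'x, 'm, 'n) functional" where
  "schouten M F G = fscl ((-1) ^ fdeg F)
     (laplace M (ftimes F G) - laplace_left M F G - laplace_right M F G)"

end

theory Submission
  imports Defs
begin

text \<open>
  Let \<open>d\<close> and \<open>e\<close> be the degrees of \<open>F\<close> and \<open>G\<close>. Up to the sign \<open>(-1)^d\<close>, the bracket of \<open>F\<close> and \<open>G\<close> is
  the part \<open>C(F, G)\<close> of \<open>\<Delta>(F \<times> G)\<close> in which one of the two deleted letters comes from \<open>F\<close> and the
  other one from \<open>G\<close>. Since \<open>-(-1)^((d - 1) (e - 1)) = (-1)^(d + e + d e)\<close>, the claim says that
  \<open>C(F, G) = (-1)^(d e) C(G, F)\<close> as functionals: the connecting part of the Laplacian inherits the
  graded commutativity of the product.

  The product of densities is graded commutative up to two identifications. Its words are commuted by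
  cyclic permutations: \<open>u v\<close> becomes \<open>v u\<close> up to sign by moving the letters of \<open>v\<close> to the front one by one
  (\<open>cyc_null_swap\<close>). And the copies of the manifold are numbered differently in \<open>F \<times> G\<close> and in
  \<open>G \<times> F\<close>; a permutation exchanging the two blocks of copies repairs this (\<open>dens_times_swap\<close>). Hence
  it remains to see that both identifications pass through the Laplacian.

  For cyclic permutations the reason is local. Deleting a letter commutes with moving the last letter
  to the front, unless it is that very letter which is deleted, and then both orders of the operations
  give the same word with the same sign (\<open>del_diff_rot\<close>). Total derivatives do not see the order of the
  letters, so they commute with cyclic permutations (\<open>shift_rot\<close>, \<open>total_d_intertwine\<close>). Thus the
  Laplacian maps differences \<open>g - rot g\<close> to such differences (\<open>laplace_term_cyc_null\<close>).

  For a permutation of the copies, every ingredient of the Laplacian is equivariant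
  (\<open>laplace_term_relabel\<close>), and identifying two copies after the permutation is the same as first
  identifying their preimages and then permuting the remaining copies (\<open>merge_permutes\<close>). So each
  summand of \<open>C(F, G)\<close> is, up to cyclic permutations and the names of the integration variables, the
  corresponding summand of \<open>C(G, F)\<close> (\<open>diagonal_term_swap\<close>).

  Linearity of the total derivatives, and their commutation with linear operators on words, rest on the
  differentiability of the coefficients. The coefficients of local functionals lie in an algebra of
  functions which is closed under partial derivatives at all configurations of points in charts
  (\<open>coeffs_derivative\<close>), and densities with such coefficients and with words from one finite set form
  the class \<open>regular\<close> in which all computations take place. At other arguments a partial derivative is an
  arbitrary value, so identities between derivatives are stated on \<open>configs M\<close> only; the relation of
  cyclic equivalence on functionals tests nothing else.
\<close>

section \<open>Linear operators on the free algebra\<close>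

definition lin_op :: "(('m, 'n) ncpoly \<Rightarrow> ('m, 'n) ncpoly) \<Rightarrow> bool" where
  "lin_op \<phi> \<longleftrightarrow> (\<forall>x y. \<phi> (x + y) = \<phi> x + \<phi> y) \<and> (\<forall>r x. \<phi> (scl r x) = scl r (\<phi> x))"

lemma lookup_scl [simp]: "Poly_Mapping.lookup (scl r x) w = r * Poly_Mapping.lookup x w"
  by (simp add: scl_def Poly_Mapping.map.rep_eq when_def)

lemma scl_simps [simp]:
  "scl r 0 = 0" "scl 0 x = 0" "scl 1 x = x" "scl r (scl s x) = scl (r * s) x"
  "scl r (Poly_Mapping.single w c) = Poly_Mapping.single w (r * c)"
  by (auto intro!: poly_mapping_eqI simp: lookup_single when_def)

lemma scl_distribs:
  "scl r (x + y) = scl r x + scl r y" "scl r (x - y) = scl r x - scl r y"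
  "scl (r + s) x = scl r x + scl s x" "scl r (- x) = - scl r x" "scl (- r) x = - scl r x"
  by (auto intro!: poly_mapping_eqI simp: lookup_add lookup_minus algebra_simps)

lemma scl_sum: "scl r (sum f S) = (\<Sum>i\<in>S. scl r (f i))"
  by (induction S rule: infinite_finite_induct) (auto simp: scl_distribs)

lemma lin_op_scl: "lin_op (scl r)"
  by (simp add: lin_op_def scl_distribs mult.commute)

lemma lin_op_add: "lin_op \<phi> \<Longrightarrow> \<phi> (x + y) = \<phi> x + \<phi> y"
  and lin_op_scale: "lin_op \<phi> \<Longrightarrow> \<phi> (scl r x) = scl r (\<phi> x)"
  by (auto simp: lin_op_def)

lemma lin_op_zero: "lin_op \<phi> \<Longrightarrow> \<phi> 0 = 0"
  using lin_op_add[of \<phi> 0 0] by simp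

lemma lin_op_minus: "lin_op \<phi> \<Longrightarrow> \<phi> (- x) = - \<phi> x"
  using lin_op_scale[of \<phi> "-1" x] by (simp add: scl_distribs)

lemma lin_op_diff: "lin_op \<phi> \<Longrightarrow> \<phi> (x - y) = \<phi> x - \<phi> y"
  using lin_op_add[of \<phi> x "- y"] lin_op_minus[of \<phi> y] by simp

lemma lin_op_sum: "lin_op \<phi> \<Longrightarrow> \<phi> (sum f S) = (\<Sum>i\<in>S. \<phi> (f i))"
  by (induction S rule: infinite_finite_induct) (auto simp: lin_op_add lin_op_zero)

lemma lin_op_comp: "lin_op \<phi> \<Longrightarrow> lin_op \<psi> \<Longrightarrow> lin_op (\<lambda>x. \<phi> (\<psi> x))"
  by (simp add: lin_op_def)

lemma lin_op_diff_op: "lin_op \<phi> \<Longrightarrow> lin_op \<psi> \<Longrightarrow> lin_op (\<lambda>x. \<phi> x - \<psi> x)"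
  by (simp add: lin_op_def scl_distribs)

lemma lin_op_id: "lin_op (\<lambda>x. x)"
  by (simp add: lin_op_def)

lemma lin_ext_over:
  assumes "finite W" "Poly_Mapping.keys x \<subseteq> W"
  shows "lin_ext T x = (\<Sum>w\<in>W. scl (Poly_Mapping.lookup x w) (T w))"
  unfolding lin_ext_def using assms
  by (intro sum.mono_neutral_left) (auto simp: in_keys_iff)

lemma lin_op_lin_ext: "lin_op (lin_ext T)"
  unfolding lin_op_def
proof (intro conjI allI)
  fix x y :: "('a, 'b) ncpoly" and r
  let ?W = "Poly_Mapping.keys x \<union> Poly_Mapping.keys y"
  have k: "Poly_Mapping.keys (x + y) \<subseteq> ?W" by (rule keys_add)
  have "lin_ext T (x + y) = (\<Sum>w\<in>?W. scl (Poly_Mapping.lookup (x + y) w) (T w))"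
    using k by (intro lin_ext_over) simp_all
  also have "\<dots> = (\<Sum>w\<in>?W. scl (Poly_Mapping.lookup x w) (T w))
      + (\<Sum>w\<in>?W. scl (Poly_Mapping.lookup y w) (T w))"
    by (simp add: lookup_add scl_distribs sum.distrib)
  also have "\<dots> = lin_ext T x + lin_ext T y"
    by (subst (1 2) lin_ext_over[of ?W]) auto
  finally show "lin_ext T (x + y) = lin_ext T x + lin_ext T y" .
  have "lin_ext T (scl r x) = (\<Sum>w\<in>Poly_Mapping.keys x. scl (Poly_Mapping.lookup (scl r x) w) (T w))"
    by (rule lin_ext_over) (auto simp: in_keys_iff)
  then show "lin_ext T (scl r x) = scl r (lin_ext T x)"
    by (simp add: lin_ext_def scl_sum)
qed

lemma lin_ext_single [simp]: "lin_ext T (Poly_Mapping.single w c) = scl c (T w)"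
  by (subst lin_ext_over[of "{w}"]) (auto simp: lookup_single)

lemma poly_as_sum:
  assumes "finite W" "Poly_Mapping.keys x \<subseteq> W"
  shows "x = (\<Sum>w\<in>W. scl (Poly_Mapping.lookup x w) (mono w))"
proof -
  have "lin_ext mono x = x"
  proof (rule poly_mapping_eqI)
    fix v
    have "Poly_Mapping.lookup (lin_ext mono x) v
        = (\<Sum>w\<in>Poly_Mapping.keys x. if w = v then Poly_Mapping.lookup x w else 0)"
      by (simp add: lin_ext_def lookup_sum lookup_single when_def if_distrib cong: if_cong)
    also have "\<dots> = Poly_Mapping.lookup x v"
      by (simp add: in_keys_iff)
    finally show "Poly_Mapping.lookup (lin_ext mono x) v = Poly_Mapping.lookup x v" .
  qed
  with lin_ext_over[OF assms, of mono] show ?thesis by simp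
qed

text \<open>
  A linear operator is determined by its values on words. With \<open>W\<close> independent of \<open>x\<close>, this turns the
  coefficients of \<open>\<phi> x\<close> into fixed linear combinations of those of \<open>x\<close>, which is what makes derivatives
  of coefficients commute with \<open>\<phi>\<close>.
\<close>

lemma lin_op_over:
  assumes "lin_op \<phi>" "finite W" "Poly_Mapping.keys x \<subseteq> W"
  shows "\<phi> x = (\<Sum>w\<in>W. scl (Poly_Mapping.lookup x w) (\<phi> (mono w)))"
proof -
  have "\<phi> x = \<phi> (\<Sum>w\<in>W. scl (Poly_Mapping.lookup x w) (mono w))"
    using poly_as_sum[OF assms(2,3)] by simp
  also have "\<dots> = (\<Sum>w\<in>W. \<phi> (scl (Poly_Mapping.lookup x w) (mono w)))"
    using assms(1) by (rule lin_op_sum)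
  finally show ?thesis by (simp only: lin_op_scale[OF assms(1)])
qed

lemma lin_op_eq_on:
  assumes "lin_op \<phi>" "lin_op \<psi>" "\<And>w. w \<in> Poly_Mapping.keys x \<Longrightarrow> \<phi> (mono w) = \<psi> (mono w)"
  shows "\<phi> x = \<psi> x"
  using lin_op_over[OF assms(1) finite_keys subset_refl, of x]
    lin_op_over[OF assms(2) finite_keys subset_refl, of x] assms(3) by simp

lemma lin_op_eqI:
  assumes "lin_op \<phi>" "lin_op \<psi>" "\<And>w. \<phi> (mono w) = \<psi> (mono w)"
  shows "\<phi> x = \<psi> x"
  by (rule lin_op_eq_on[OF assms(1,2)]) (rule assms(3))

lemma lin_op_bilin_left: "lin_op (\<lambda>x. bilin_ext B x y)"
  unfolding bilin_ext_def by (rule lin_op_lin_ext)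

lemma lin_op_lin_ext_fun:
  assumes "\<And>u. lin_op (\<lambda>y. T y u)" shows "lin_op (\<lambda>y. lin_ext (T y) x)"
  using assms by (simp add: lin_op_def lin_ext_def sum.distrib scl_distribs scl_sum mult.commute)

lemma lin_op_bilin_right: "lin_op (\<lambda>y. bilin_ext B x y)"
  unfolding bilin_ext_def by (rule lin_op_lin_ext_fun) (rule lin_op_lin_ext)

lemma bilin_ext_mono [simp]: "bilin_ext B (mono u) (mono v) = B u v"
  by (simp add: bilin_ext_def)

lemma bilin_eq_on:
  assumes "\<And>x. lin_op (\<lambda>y. \<phi> x y)" "\<And>y. lin_op (\<lambda>x. \<phi> x y)"
    and "\<And>x. lin_op (\<lambda>y. \<psi> x y)" "\<And>y. lin_op (\<lambda>x. \<psi> x y)"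
    and "\<And>u v. u \<in> Poly_Mapping.keys x \<Longrightarrow> v \<in> Poly_Mapping.keys y
      \<Longrightarrow> \<phi> (mono u) (mono v) = \<psi> (mono u) (mono v)"
  shows "\<phi> x y = \<psi> x y"
proof (rule lin_op_eq_on[where \<phi> = "\<lambda>x. \<phi> x y" and \<psi> = "\<lambda>x. \<psi> x y", OF assms(2,4)])
  fix u assume u: "u \<in> Poly_Mapping.keys x"
  show "\<phi> (mono u) y = \<psi> (mono u) y"
    by (rule lin_op_eq_on[OF assms(1,3)]) (rule assms(5)[OF u])
qed

lemma keys_lin_op:
  assumes "lin_op \<phi>"
  shows "Poly_Mapping.keys (\<phi> x) \<subseteq> (\<Union>w\<in>Poly_Mapping.keys x. Poly_Mapping.keys (\<phi> (mono w)))"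
proof
  fix v assume "v \<in> Poly_Mapping.keys (\<phi> x)"
  then have "Poly_Mapping.lookup (\<phi> x) v \<noteq> 0" by (simp add: in_keys_iff)
  then have "(\<Sum>w\<in>Poly_Mapping.keys x. Poly_Mapping.lookup x w * Poly_Mapping.lookup (\<phi> (mono w)) v) \<noteq> 0"
    by (subst (asm) lin_op_over[OF assms finite_keys subset_refl]) (simp add: lookup_sum)
  then obtain w where "w \<in> Poly_Mapping.keys x" "Poly_Mapping.lookup (\<phi> (mono w)) v \<noteq> 0"
    by (metis (no_types, lifting) sum.neutral mult_zero_right)
  then show "v \<in> (\<Union>w\<in>Poly_Mapping.keys x. Poly_Mapping.keys (\<phi> (mono w)))"
    by (auto simp: in_keys_iff)
qed

section \<open>Rotations, cyclic words and their products\<close>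

lemma lin_op_rot: "lin_op rot"
  unfolding rot_def by (rule lin_op_lin_ext)

lemma rot_mono: "rot (mono w) = rot_word w"
  by (simp add: rot_def)

lemma wdeg_simps [simp]:
  "wdeg [] = 0" "wdeg (u @ v) = wdeg u + wdeg v"
  "wdeg (x # y # w) = wdeg [x] + wdeg (y # w)"
  by (auto simp: wdeg_def)

lemma wdeg_Cons: "wdeg (x # w) = wdeg [x] + wdeg w"
  by (cases w) simp_all

lemma rot_snoc: "rot (mono (w @ [x])) = Poly_Mapping.single (x # w) ((-1) ^ (wdeg w * wdeg [x]))"
  by (simp add: rot_mono rot_word_def)

lemma cyc_nullI: "g - rot g \<in> cyc_null"
  by (auto simp: cyc_null_def)

lemma cyc_null_subspace:
  shows cyc_null_zero: "0 \<in> cyc_null"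
    and cyc_null_add: "x \<in> cyc_null \<Longrightarrow> y \<in> cyc_null \<Longrightarrow> x + y \<in> cyc_null"
    and cyc_null_scl: "x \<in> cyc_null \<Longrightarrow> scl r x \<in> cyc_null"
proof -
  show "0 \<in> cyc_null" using cyc_nullI[of 0] by (simp add: lin_op_zero[OF lin_op_rot])
  show "x + y \<in> cyc_null" if xy: "x \<in> cyc_null" "y \<in> cyc_null"
  proof -
    obtain a b where "x = a - rot a" "y = b - rot b" using xy by (auto simp: cyc_null_def)
    then have "x + y = (a + b) - rot (a + b)" by (simp add: lin_op_add[OF lin_op_rot])
    then show ?thesis by (simp only: cyc_nullI)
  qed
  show "scl r x \<in> cyc_null" if x: "x \<in> cyc_null"
  proof -
    obtain a where "x = a - rot a" using x by (auto simp: cyc_null_def)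
    then have "scl r x = scl r a - rot (scl r a)"
      by (simp add: lin_op_scale[OF lin_op_rot] scl_distribs)
    then show ?thesis by (simp only: cyc_nullI)
  qed
qed

lemma cyc_null_sum: "(\<And>i. i \<in> S \<Longrightarrow> f i \<in> cyc_null) \<Longrightarrow> sum f S \<in> cyc_null"
  by (induction S rule: infinite_finite_induct) (auto intro: cyc_null_zero cyc_null_add)

lemma cyc_null_Sum_any: "(\<And>i. f i \<in> cyc_null) \<Longrightarrow> Sum_any f \<in> cyc_null"
  unfolding Sum_any.expand_set by (rule cyc_null_sum)

text \<open>
  Each rotation moves one letter of \<open>v\<close> in front of \<open>u\<close>. The letter \<open>x\<close> passes \<open>u\<close> and the rest of \<open>v\<close>,
  but the rest of \<open>v\<close> later passes \<open>x\<close> as well, so that only the sign for exchanging \<open>u\<close> and \<open>v\<close> remains.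
\<close>

lemma cyc_null_swap:
  "mono (u @ v) - scl ((-1) ^ (wdeg u * wdeg v)) (mono (v @ u)) \<in> cyc_null"
proof (induction v arbitrary: u rule: rev_induct)
  case Nil
  then show ?case by (simp add: cyc_null_zero)
next
  case (snoc x v)
  let ?s = "(-1::real) ^ (wdeg (u @ v) * wdeg [x])"
  have "mono (u @ v @ [x]) - rot (mono ((u @ v) @ [x])) \<in> cyc_null"
    using cyc_nullI[of "mono ((u @ v) @ [x])"] by simp
  then have 1: "mono (u @ v @ [x]) - scl ?s (mono ((x # u) @ v)) \<in> cyc_null"
    unfolding rot_snoc by simp
  have 2: "scl ?s (mono ((x # u) @ v) - scl ((-1) ^ (wdeg (x # u) * wdeg v)) (mono (v @ x # u))) \<in> cyc_null"
    by (rule cyc_null_scl) (rule snoc)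
  have s: "?s * (-1) ^ (wdeg (x # u) * wdeg v) = (-1) ^ (wdeg u * wdeg (v @ [x]))"
    by (simp add: wdeg_Cons[of x u] algebra_simps flip: power_add)
       (simp add: minus_one_power_iff)
  show ?case
    using cyc_null_add[OF 1 2] by (simp add: scl_distribs s[simplified])
qed

text \<open>
  Rotations keep a word a multiple of a word of the same degree, so that the exchange of two words
  applies to all summands of their product.
\<close>

lemma rot_pow_mono:
  "\<exists>c u'. (rot ^^ i) (mono u) = scl c (mono u') \<and> wdeg u' = wdeg u \<and> length u' = length u
     \<and> set u' = set u"
proof (induction i)
  case 0
  have "(rot ^^ 0) (mono u) = scl 1 (mono u)" by simp
  then show ?case by blast
next
  case (Suc i)
  then obtain c u' where u': "(rot ^^ i) (mono u) = scl c (mono u')" "wdeg u' = wdeg u"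
    "length u' = length u" "set u' = set u" by blast
  show ?case
  proof (cases u' rule: rev_cases)
    case Nil
    then have "(rot ^^ Suc i) (mono u) = scl c (mono u')"
      by (simp only: funpow.simps o_apply u'(1) lin_op_scale[OF lin_op_rot] rot_mono)
         (simp add: rot_word_def)
    with u' show ?thesis by blast
  next
    case (snoc w x)
    have "(rot ^^ Suc i) (mono u) = scl (c * (-1) ^ (wdeg w * wdeg [x])) (mono (x # w))"
      by (simp only: funpow.simps o_apply u'(1) lin_op_scale[OF lin_op_rot] snoc rot_snoc) simp
    moreover have "wdeg (x # w) = wdeg u" "length (x # w) = length u" "set (x # w) = set u"
      using u'(2-4) snoc by (auto simp: wdeg_Cons[of x w])
    ultimately show ?thesis by blast
  qed
qed

lemma nc_mult_mono [simp]: "nc_mult (mono u) (mono v) = mono (u @ v)"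
  by (simp add: nc_mult_def)

lemma lin_op_nc_mult: "lin_op (\<lambda>x. nc_mult x y)" "lin_op (\<lambda>y. nc_mult x y)"
  unfolding nc_mult_def by (rule lin_op_bilin_left lin_op_bilin_right)+

lemma nc_mult_scl_mono: "nc_mult (scl a (mono u)) (scl b (mono v)) = scl (a * b) (mono (u @ v))"
  by (simp only: lin_op_scale[OF lin_op_nc_mult(1)] lin_op_scale[OF lin_op_nc_mult(2)] nc_mult_mono
      scl_simps(4) mult.commute)

text \<open>
  The product averages over all rotations of both factors, and so does the product with the factors
  exchanged; corresponding summands are cyclic permutations of each other.
\<close>

lemma word_times_swap:
  "word_times u v - scl ((-1) ^ (wdeg u * wdeg v)) (word_times v u) \<in> cyc_null"
proof (cases "u = [] \<or> v = []")
  case True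
  then show ?thesis by (auto simp: word_times_def cyc_null_zero)
next
  case False
  let ?s = "(-1) ^ (wdeg u * wdeg v)" and ?c = "1 / (real (length u) * real (length v))"
  let ?x = "\<lambda>i. (rot ^^ i) (mono u)" and ?y = "\<lambda>j. (rot ^^ j) (mono v)"
  have *: "nc_mult (?x i) (?y j) - scl ?s (nc_mult (?y j) (?x i)) \<in> cyc_null" for i j
  proof -
    obtain a u' where u': "?x i = scl a (mono u')" "wdeg u' = wdeg u"
      using rot_pow_mono by blast
    obtain b v' where v': "?y j = scl b (mono v')" "wdeg v' = wdeg v"
      using rot_pow_mono by blast
    show ?thesis
      using cyc_null_scl[OF cyc_null_swap[of u' v'], of "a * b"]
      by (simp only: u' v' nc_mult_scl_mono) (simp add: scl_distribs mult_ac)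
  qed
  have "word_times u v - scl ?s (word_times v u)
      = scl ?c ((\<Sum>i<length u. \<Sum>j<length v. nc_mult (?x i) (?y j))
        - scl ?s (\<Sum>j<length v. \<Sum>i<length u. nc_mult (?y j) (?x i)))"
    using False by (simp add: word_times_def scl_distribs mult_ac)
  also have "\<dots> = scl ?c (\<Sum>i<length u. \<Sum>j<length v.
      nc_mult (?x i) (?y j) - scl ?s (nc_mult (?y j) (?x i)))"
    by (subst (2) sum.swap) (simp add: scl_sum sum_subtractf)
  finally show ?thesis
    using * by (auto intro!: cyc_null_scl cyc_null_sum)
qed

lemma set_word_times:
  assumes "w \<in> Poly_Mapping.keys (word_times u v)" shows "set w \<subseteq> set u \<union> set v"
proof (cases "u = [] \<or> v = []")
  case True
  with assms show ?thesis by (auto simp: word_times_def split: if_splits)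
next
  case False
  have "Poly_Mapping.lookup (word_times u v) w \<noteq> 0" using assms by (simp add: in_keys_iff)
  then have "(\<Sum>i<length u. \<Sum>j<length v. Poly_Mapping.lookup
      (nc_mult ((rot ^^ i) (mono u)) ((rot ^^ j) (mono v))) w) \<noteq> 0"
    using False by (simp add: word_times_def lookup_sum)
  then obtain i j where ij: "Poly_Mapping.lookup
      (nc_mult ((rot ^^ i) (mono u)) ((rot ^^ j) (mono v))) w \<noteq> 0"
    by (metis (no_types, lifting) sum.neutral)
  obtain a u' where u': "(rot ^^ i) (mono u) = scl a (mono u')" "set u' = set u"
    using rot_pow_mono by blast
  obtain b v' where v': "(rot ^^ j) (mono v) = scl b (mono v')" "set v' = set v"
    using rot_pow_mono by blast
  have "w = u' @ v'"
    using ij unfolding u'(1) v'(1) nc_mult_scl_mono by (auto simp: lookup_single when_def split: if_splits)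
  then show ?thesis using u'(2) v'(2) by simp
qed

section \<open>Renaming, deletion and shifts of letters\<close>

text \<open>
  The action of \<^const>\<open>relabel\<close> at a single configuration.
\<close>

definition ren :: "(nat \<Rightarrow> nat) \<Rightarrow> ('m, 'n) ncpoly \<Rightarrow> ('m, 'n) ncpoly" where
  "ren r = lin_ext (\<lambda>w. mono (map (map_prod r id) w))"

lemma relabel_ren: "relabel r h p = ren r (h (p \<circ> r))"
  by (simp add: relabel_def ren_def)

lemma lin_op_ren: "lin_op (ren r)"
  unfolding ren_def by (rule lin_op_lin_ext)

lemma ren_mono [simp]: "ren r (mono w) = mono (map (map_prod r id) w)"
  by (simp add: ren_def)

lemma ren_ren: "ren r (ren s x) = ren (r \<circ> s) x"
  by (rule lin_op_eqI[OF lin_op_comp[OF lin_op_ren lin_op_ren] lin_op_ren])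
     (simp add: map_prod.comp)

lemma relabel_relabel: "relabel r (relabel s h) = relabel (r \<circ> s) h"
  by (rule ext) (simp add: relabel_ren ren_ren o_assoc)

lemma wdeg_ren [simp]: "wdeg (map (map_prod r id) w) = wdeg w"
  by (simp add: wdeg_def filter_map o_def case_prod_unfold)

lemma ren_rot: "ren r (rot x) = rot (ren r x)"
proof (rule lin_op_eqI[OF lin_op_comp[OF lin_op_ren lin_op_rot] lin_op_comp[OF lin_op_rot lin_op_ren]])
  fix w :: "('a, 'b) word"
  show "ren r (rot (mono w)) = rot (ren r (mono w))"
  proof (cases w rule: rev_cases)
    case (snoc u x)
    have "wdeg [map_prod r id x] = wdeg [x]" using wdeg_ren[of r "[x]"] by simp
    then show ?thesis
      unfolding snoc rot_snoc by (simp add: rot_snoc ren_def)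
  qed (simp add: rot_mono rot_word_def)
qed

lemma ren_cyc_null: "x \<in> cyc_null \<Longrightarrow> ren r x \<in> cyc_null"
  by (auto simp: cyc_null_def lin_op_diff[OF lin_op_ren] ren_rot)

lemma ren_rot_pow: "ren r ((rot ^^ i) x) = (rot ^^ i) (ren r x)"
  by (induction i) (simp_all add: ren_rot)

lemma ren_nc_mult: "ren r (nc_mult x y) = nc_mult (ren r x) (ren r y)"
  by (rule bilin_eq_on[OF lin_op_comp[OF lin_op_ren lin_op_nc_mult(2)]
        lin_op_comp[OF lin_op_ren lin_op_nc_mult(1)] lin_op_comp[OF lin_op_nc_mult(2) lin_op_ren]
        lin_op_comp[OF lin_op_nc_mult(1) lin_op_ren]]) simp

lemma ren_word_times:
  "ren r (word_times u v) = word_times (map (map_prod r id) u) (map (map_prod r id) v)"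
  by (simp add: word_times_def lin_op_scale[OF lin_op_ren] lin_op_sum[OF lin_op_ren] ren_nc_mult
      ren_rot_pow)

lemma lin_op_cyc_times: "lin_op (\<lambda>x. cyc_times x y)" "lin_op (\<lambda>y. cyc_times x y)"
  unfolding cyc_times_def by (rule lin_op_bilin_left lin_op_bilin_right)+

lemma cyc_times_mono: "cyc_times (mono u) (mono v) = word_times u v"
  by (simp add: cyc_times_def)

lemma ren_cyc_times: "ren r (cyc_times x y) = cyc_times (ren r x) (ren r y)"
  by (rule bilin_eq_on[OF lin_op_comp[OF lin_op_ren lin_op_cyc_times(2)]
        lin_op_comp[OF lin_op_ren lin_op_cyc_times(1)] lin_op_comp[OF lin_op_cyc_times(2) lin_op_ren]
        lin_op_comp[OF lin_op_cyc_times(1) lin_op_ren]]) (simp add: cyc_times_mono ren_word_times)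

text \<open>
  Deletion at all positions but the last, i.e. of a letter which the next rotation leaves behind.
\<close>

definition del_init :: "nat \<times> ('m, 'n) letter \<Rightarrow> ('m, 'n) word \<Rightarrow> ('m, 'n) ncpoly" where
  "del_init l w = (\<Sum>\<nu> | \<nu> < length w - 1 \<and> w ! \<nu> = l.
     Poly_Mapping.single (take \<nu> w @ drop (Suc \<nu>) w) ((-1) ^ (wdeg [l] * wdeg (take \<nu> w))))"

lemma minus_one_power_eq_cong: "even (a + b) \<Longrightarrow> (-1::real) ^ a = (-1) ^ b"
  by (simp add: minus_one_power_iff)

lemma del_letter_snoc:
  "del_letter l (w @ [x]) = del_init l (w @ [x])
     + (if x = l then Poly_Mapping.single w ((-1) ^ (wdeg [l] * wdeg w)) else 0)"
proof -
  have "{\<nu>. \<nu> < length (w @ [x]) \<and> (w @ [x]) ! \<nu> = l}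
    = {\<nu>. \<nu> < length (w @ [x]) - 1 \<and> (w @ [x]) ! \<nu> = l} \<union> (if x = l then {length w} else {})"
    by (auto simp: nth_append less_Suc_eq split: if_splits)
  moreover have "{\<nu>. \<nu> < length (w @ [x]) - 1 \<and> (w @ [x]) ! \<nu> = l} \<inter> {length w} = {}"
    by auto
  ultimately show ?thesis
    unfolding del_letter_def del_init_def by (simp add: sum.union_disjoint)
qed

lemma del_init_snoc:
  "del_init l (w @ [x]) = (\<Sum>\<nu> | \<nu> < length w \<and> w ! \<nu> = l.
     Poly_Mapping.single (take \<nu> w @ drop (Suc \<nu>) w @ [x]) ((-1) ^ (wdeg [l] * wdeg (take \<nu> w))))"
  unfolding del_init_def by (rule sum.cong) (auto simp: nth_append)

lemma del_letter_Cons: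
  "del_letter l (x # w) = (if x = l then mono w else 0)
     + (\<Sum>\<nu> | \<nu> < length w \<and> w ! \<nu> = l.
        Poly_Mapping.single (x # take \<nu> w @ drop (Suc \<nu>) w)
          ((-1) ^ (wdeg [l] * (wdeg [x] + wdeg (take \<nu> w)))))"
proof -
  have "{\<nu>. \<nu> < length (x # w) \<and> (x # w) ! \<nu> = l}
    = (if x = l then {0} else {}) \<union> Suc ` {\<nu>. \<nu> < length w \<and> w ! \<nu> = l}" (is "_ = ?A \<union> Suc ` ?B")
  proof (intro equalityI subsetI)
    fix \<nu> assume "\<nu> \<in> {\<nu>. \<nu> < length (x # w) \<and> (x # w) ! \<nu> = l}"
    then show "\<nu> \<in> ?A \<union> Suc ` ?B" by (cases \<nu>) auto
  qed (auto split: if_splits)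
  moreover have "?A \<inter> Suc ` ?B = {}" by auto
  ultimately have "del_letter l (x # w) = (if x = l then mono w else 0)
      + (\<Sum>\<nu>\<in>Suc ` ?B. Poly_Mapping.single (take \<nu> (x # w) @ drop (Suc \<nu>) (x # w))
          ((-1) ^ (wdeg [l] * wdeg (take \<nu> (x # w)))))"
    unfolding del_letter_def by (simp add: sum.union_disjoint)
  then show ?thesis by (simp add: sum.reindex wdeg_Cons[of x "take _ w"])
qed

text \<open>
  Deletion before and after a rotation compares as follows. Deleting the last letter \<open>x\<close> of \<open>w x\<close>, or
  deleting it from the front after the rotation, gives \<open>w\<close> with the same sign: on the left \<open>x\<close> is reached
  by passing \<open>w\<close>, on the right the rotation has paid for that. These terms cancel. Deleting another
  letter commutes with the rotation: if it is done first, \<open>x\<close> need not pass the deleted letter; if it is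
  done afterwards, the deletion has to pass \<open>x\<close>; and the same sign enters twice.
\<close>

lemma del_diff_rot:
  "lin_ext (del_letter l) (x - rot x) = lin_ext (del_init l) x - rot (lin_ext (del_init l) x)"
proof (rule lin_op_eqI[of "\<lambda>x. lin_ext (del_letter l) (x - rot x)"
      "\<lambda>x. lin_ext (del_init l) x - rot (lin_ext (del_init l) x)",
      OF lin_op_comp[OF lin_op_lin_ext lin_op_diff_op[OF lin_op_id lin_op_rot]]
        lin_op_diff_op[OF lin_op_lin_ext lin_op_comp[OF lin_op_rot lin_op_lin_ext]]])
  fix w :: "('a, 'b) word"
  show "lin_ext (del_letter l) (mono w - rot (mono w))
      = lin_ext (del_init l) (mono w) - rot (lin_ext (del_init l) (mono w))"
  proof (cases w rule: rev_cases)
    case Nil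
    then show ?thesis
      by (simp add: rot_mono rot_word_def del_init_def lin_op_zero[OF lin_op_lin_ext]
          lin_op_zero[OF lin_op_rot])
  next
    case (snoc u x)
    let ?B = "{\<nu>. \<nu> < length u \<and> u ! \<nu> = l}"
    have "rot (del_init l (u @ [x])) = (\<Sum>\<nu>\<in>?B. scl ((-1) ^ (wdeg [l] * wdeg (take \<nu> u)))
        (rot (mono ((take \<nu> u @ drop (Suc \<nu>) u) @ [x]))))"
      unfolding del_init_snoc lin_op_sum[OF lin_op_rot]
      by (simp flip: lin_op_scale[OF lin_op_rot])
    also have "\<dots> = (\<Sum>\<nu>\<in>?B. scl ((-1) ^ (wdeg u * wdeg [x]))
        (Poly_Mapping.single (x # take \<nu> u @ drop (Suc \<nu>) u)
          ((-1) ^ (wdeg [l] * (wdeg [x] + wdeg (take \<nu> u))))))"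
    proof (rule sum.cong)
      fix \<nu> assume "\<nu> \<in> ?B"
      then have "wdeg u = wdeg (take \<nu> u) + wdeg [l] + wdeg (drop (Suc \<nu>) u)"
        by (metis (mono_tags, lifting) id_take_nth_drop mem_Collect_eq wdeg_Cons wdeg_simps(2) add.assoc)
      then show "scl ((-1) ^ (wdeg [l] * wdeg (take \<nu> u)))
          (rot (mono ((take \<nu> u @ drop (Suc \<nu>) u) @ [x])))
        = scl ((-1) ^ (wdeg u * wdeg [x])) (Poly_Mapping.single (x # take \<nu> u @ drop (Suc \<nu>) u)
          ((-1) ^ (wdeg [l] * (wdeg [x] + wdeg (take \<nu> u)))))"
        unfolding rot_snoc
        by (simp flip: power_add) (rule arg_cong[where f = "Poly_Mapping.single _"],
          rule minus_one_power_eq_cong, simp add: algebra_simps)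
    qed simp
    finally have r: "rot (del_init l (u @ [x])) = \<dots>" .
    have "lin_ext (del_letter l) (rot (mono (u @ [x])))
      = scl ((-1) ^ (wdeg u * wdeg [x])) (del_letter l (x # u))"
      by (simp add: rot_snoc)
    also have "\<dots> = rot (del_init l (u @ [x]))
       + (if x = l then Poly_Mapping.single u ((-1) ^ (wdeg [l] * wdeg u)) else 0)"
      unfolding r del_letter_Cons by (simp add: scl_distribs scl_sum mult.commute)
    finally show ?thesis
      unfolding snoc lin_op_diff[OF lin_op_lin_ext] by (simp add: del_letter_snoc)
  qed
qed

lemma del_ren:
  assumes "inj r"
  shows "lin_ext (del_letter (r \<alpha>, l)) (ren r x) = ren r (lin_ext (del_letter (\<alpha>, l)) x)"
proof (rule lin_op_eqI[OF lin_op_comp[OF lin_op_lin_ext lin_op_ren] lin_op_comp[OF lin_op_ren lin_op_lin_ext]])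
  fix w :: "('a, 'b) word"
  have [simp]: "map_prod r id y = (r \<alpha>, l) \<longleftrightarrow> y = (\<alpha>, l)" for y
    using inj_eq[OF assms] by (cases y) auto
  moreover have "wdeg [(r \<alpha>, l)] = wdeg [(\<alpha>, l)]" by (simp add: wdeg_def)
  ultimately show "lin_ext (del_letter (r \<alpha>, l)) (ren r (mono w)) = ren r (lin_ext (del_letter (\<alpha>, l)) (mono w))"
    by (simp add: del_letter_def lin_op_sum[OF lin_op_ren])
       (rule sum.cong, auto simp: take_map drop_map ren_def)
qed

lemma shift_ren:
  assumes "inj r"
  shows "lin_ext (shift_jet (r \<alpha>) k) (ren r x) = ren r (lin_ext (shift_jet \<alpha> k) x)"
proof (rule lin_op_eqI[OF lin_op_comp[OF lin_op_lin_ext lin_op_ren] lin_op_comp[OF lin_op_ren lin_op_lin_ext]])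
  fix w :: "('a, 'b) word"
  show "lin_ext (shift_jet (r \<alpha>) k) (ren r (mono w)) = ren r (lin_ext (shift_jet \<alpha> k) (mono w))"
    by (simp add: shift_jet_def lin_op_sum[OF lin_op_ren])
       (rule sum.cong, auto simp: inj_eq[OF assms] map_update)
qed

definition shifted :: "'n \<Rightarrow> nat \<times> ('m, 'n) letter \<Rightarrow> nat \<times> ('m, 'n) letter" where
  "shifted k x = (fst x, set_jet (add_mset k (jet (snd x))) (snd x))"

lemma wdeg_shifted [simp]: "wdeg [shifted k x] = wdeg [x]"
  by (cases x; cases "snd x") (auto simp: wdeg_def shifted_def)

lemma shift_jet_shifted:
  "shift_jet \<alpha> k w = (\<Sum>\<nu> | \<nu> < length w \<and> fst (w ! \<nu>) = \<alpha>. mono (w[\<nu> := shifted k (w ! \<nu>)]))"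
  unfolding shift_jet_def by (rule sum.cong) (auto simp: shifted_def)

lemma wdeg_update_shifted: "\<nu> < length w \<Longrightarrow> wdeg (w[\<nu> := shifted k (w ! \<nu>)]) = wdeg w"
  by (metis id_take_nth_drop upd_conv_take_nth_drop wdeg_Cons wdeg_shifted wdeg_simps(2))

lemma shift_jet_snoc:
  "shift_jet \<alpha> k (w @ [x]) = (\<Sum>\<nu> | \<nu> < length w \<and> fst (w ! \<nu>) = \<alpha>.
      mono (w[\<nu> := shifted k (w ! \<nu>)] @ [x])) + (if fst x = \<alpha> then mono (w @ [shifted k x]) else 0)"
proof -
  have "{\<nu>. \<nu> < length (w @ [x]) \<and> fst ((w @ [x]) ! \<nu>) = \<alpha>}
    = {\<nu>. \<nu> < length w \<and> fst (w ! \<nu>) = \<alpha>} \<union> (if fst x = \<alpha> then {length w} else {})"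
    by (auto simp: nth_append less_Suc_eq split: if_splits)
  moreover have "(\<Sum>\<nu> | \<nu> < length w \<and> fst (w ! \<nu>) = \<alpha>.
      mono ((w @ [x])[\<nu> := shifted k ((w @ [x]) ! \<nu>)])) =
    (\<Sum>\<nu> | \<nu> < length w \<and> fst (w ! \<nu>) = \<alpha>. mono (w[\<nu> := shifted k (w ! \<nu>)] @ [x]))"
    by (rule sum.cong) (auto simp: nth_append list_update_append)
  ultimately show ?thesis
    unfolding shift_jet_shifted by (simp add: sum.union_disjoint)
qed

lemma shift_jet_Cons:
  "shift_jet \<alpha> k (x # w) = (if fst x = \<alpha> then mono (shifted k x # w) else 0)
     + (\<Sum>\<nu> | \<nu> < length w \<and> fst (w ! \<nu>) = \<alpha>. mono (x # w[\<nu> := shifted k (w ! \<nu>)]))"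
proof -
  have "{\<nu>. \<nu> < length (x # w) \<and> fst ((x # w) ! \<nu>) = \<alpha>}
    = (if fst x = \<alpha> then {0} else {}) \<union> Suc ` {\<nu>. \<nu> < length w \<and> fst (w ! \<nu>) = \<alpha>}"
    (is "_ = ?A \<union> Suc ` ?B")
  proof (intro equalityI subsetI)
    fix \<nu> assume "\<nu> \<in> {\<nu>. \<nu> < length (x # w) \<and> fst ((x # w) ! \<nu>) = \<alpha>}"
    then show "\<nu> \<in> ?A \<union> Suc ` ?B" by (cases \<nu>) auto
  qed (auto split: if_splits)
  moreover have "?A \<inter> Suc ` ?B = {}" by auto
  ultimately show ?thesis
    unfolding shift_jet_shifted by (simp add: sum.union_disjoint sum.reindex)
qed

text \<open>
  The shift of a jet index leaves the degree of a letter unchanged, so it does not affect signs.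
\<close>

lemma shift_rot: "lin_ext (shift_jet \<alpha> k) (rot x) = rot (lin_ext (shift_jet \<alpha> k) x)"
proof (rule lin_op_eqI[OF lin_op_comp[OF lin_op_lin_ext lin_op_rot] lin_op_comp[OF lin_op_rot lin_op_lin_ext]])
  fix w :: "('a, 'b) word"
  show "lin_ext (shift_jet \<alpha> k) (rot (mono w)) = rot (lin_ext (shift_jet \<alpha> k) (mono w))"
  proof (cases w rule: rev_cases)
    case Nil
    then show ?thesis
      by (simp add: rot_mono rot_word_def shift_jet_def lin_op_zero[OF lin_op_rot])
  next
    case (snoc u x)
    have if_rot: "rot (if b then y else 0) = (if b then rot y else 0)" for b and y :: "('a, 'b) ncpoly"
      by (simp add: lin_op_zero[OF lin_op_rot])
    show ?thesis
      unfolding snoc rot_snoc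
      by (simp add: shift_jet_snoc shift_jet_Cons lin_op_add[OF lin_op_rot] lin_op_sum[OF lin_op_rot]
          if_rot rot_snoc scl_distribs scl_sum add.commute) (simp add: wdeg_update_shifted)
  qed
qed


section \<open>Smooth coefficients over several copies\<close>

abbreviation move :: "('c, 'x, 'n::finite) mfd \<Rightarrow> nat \<Rightarrow> 'n \<Rightarrow> real \<Rightarrow> ('c, 'x) config \<Rightarrow> ('c, 'x) config" where
  "move M \<alpha> k t p \<equiv> p(\<alpha> := step M k t (p \<alpha>))"

text \<open>
  The algebra generated by smooth functions of single points. Membership in the tensor powers
  \<open>multi_coeffs M L\<close> would require normal forms of products; an algebra closed under all operations in
  sight is easier to work with. The clause \<open>cong\<close> discards the values outside of the configurations,
  where partial derivatives are not controlled.
\<close>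

inductive_set smooth_coeffs ::
  "('c, 'x::topological_space, 'n::finite) mfd \<Rightarrow> (('c, 'x) config \<Rightarrow> real) set"
  for M :: "('c, 'x, 'n) mfd" where
  const: "(\<lambda>p. c) \<in> smooth_coeffs M"
| pull: "smooth M e \<Longrightarrow> (\<lambda>p. e (p i)) \<in> smooth_coeffs M"
| add: "f \<in> smooth_coeffs M \<Longrightarrow> g \<in> smooth_coeffs M \<Longrightarrow> (\<lambda>p. f p + g p) \<in> smooth_coeffs M"
| mult: "f \<in> smooth_coeffs M \<Longrightarrow> g \<in> smooth_coeffs M \<Longrightarrow> (\<lambda>p. f p * g p) \<in> smooth_coeffs M"
| cong: "f \<in> smooth_coeffs M \<Longrightarrow> (\<And>p. p \<in> configs M \<Longrightarrow> f p = g p) \<Longrightarrow> g \<in> smooth_coeffs M"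

lemma coeffs_sum:
  "(\<And>i. i \<in> S \<Longrightarrow> f i \<in> smooth_coeffs M) \<Longrightarrow> (\<lambda>p. \<Sum>i\<in>S. f i p) \<in> smooth_coeffs M"
  by (induction S rule: infinite_finite_induct) (auto intro: smooth_coeffs.const smooth_coeffs.add)

lemma coeffs_prod:
  "(\<And>i. i \<in> S \<Longrightarrow> f i \<in> smooth_coeffs M) \<Longrightarrow> (\<lambda>p. \<Prod>i\<in>S. f i p) \<in> smooth_coeffs M"
  by (induction S rule: infinite_finite_induct) (auto intro: smooth_coeffs.const smooth_coeffs.mult)

lemma configs_comp: "p \<in> configs M \<Longrightarrow> p \<circ> r \<in> configs M"
  by (simp add: configs_def)

lemma coeffs_comp: "f \<in> smooth_coeffs M \<Longrightarrow> (\<lambda>p. f (p \<circ> r)) \<in> smooth_coeffs M"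
proof (induction rule: smooth_coeffs.induct)
  case (pull e i)
  then show ?case using smooth_coeffs.pull[of M e "r i"] by simp
next
  case (cong f g)
  show ?case by (rule smooth_coeffs.cong[OF cong.IH cong.hyps(2)[OF configs_comp]])
qed (simp_all add: smooth_coeffs.const smooth_coeffs.add smooth_coeffs.mult)

lemma multi_coeffs_subset: "multi_coeffs M L \<subseteq> smooth_coeffs M"
proof
  fix f assume "f \<in> multi_coeffs M L"
  then obtain N r e where e: "\<forall>s<(N::nat). \<forall>i<L. e s i \<in> admissible_coeffs M"
    and f: "f = (\<lambda>p. \<Sum>s<N. r s * (\<Prod>i<L. e s i (p i)))"
    unfolding multi_coeffs_def by blast
  show "f \<in> smooth_coeffs M"
    unfolding f using e
    by (intro coeffs_sum smooth_coeffs.mult smooth_coeffs.const coeffs_prod smooth_coeffs.pull)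
       (auto simp: admissible_coeffs_def)
qed

lemma step_0:
  assumes "affine_manifold M" "u \<in> local_pts M" shows "step M k 0 u = u"
proof -
  obtain c x where u: "u = (c, x)" "x \<in> chart_dom M c"
    using assms(2) by (auto simp: local_pts_def)
  have "homeomorphism (chart_dom M c) (chart M c ` chart_dom M c) (chart M c) (chart_inv M c)"
    using assms(1) unfolding affine_manifold_def by blast
  from homeomorphism_apply1[OF this u(2)] show ?thesis by (simp add: u(1) step_def)
qed

lemma eventually_step:
  assumes "affine_manifold M" "u \<in> local_pts M"
  shows "\<forall>\<^sub>F t in nhds 0. step M k t u \<in> local_pts M"
proof -
  obtain c x where u: "u = (c, x)" "x \<in> chart_dom M c"
    using assms(2) by (auto simp: local_pts_def)
  let ?U = "chart M c ` chart_dom M c"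
  have "open ?U" using assms(1) by (simp add: affine_manifold_def)
  moreover have "((\<lambda>t. chart M c x + t *\<^sub>R axis k 1) \<longlongrightarrow> chart M c x + 0 *\<^sub>R axis k 1) (nhds 0)"
    by (intro tendsto_intros filterlim_ident)
  ultimately have "\<forall>\<^sub>F t in nhds 0. chart M c x + t *\<^sub>R axis k 1 \<in> ?U"
    using u(2) by (auto dest: topological_tendstoD)
  then show ?thesis
    by eventually_elim (simp add: u(1) step_def local_pts_def inv_into_into)
qed

text \<open>
  Chart images are open, so a small coordinate step stays inside of the chart. Hence derivatives at
  configurations only depend on the values at configurations.
\<close>

lemma eventually_move:
  assumes "affine_manifold M" "p \<in> configs M"
  shows "\<forall>\<^sub>F t in nhds 0. move M \<alpha> k t p \<in> configs M"
proof -
  have "p \<alpha> \<in> local_pts M" using assms(2) by (simp add: configs_def)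
  from eventually_step[OF assms(1) this, of k] show ?thesis
    by eventually_elim (use assms(2) in \<open>simp add: configs_def\<close>)
qed

lemma move_0: "affine_manifold M \<Longrightarrow> p \<in> configs M \<Longrightarrow> move M \<alpha> k 0 p = p"
  by (simp add: step_0 configs_def)

lemma smooth_pd: "smooth M e \<Longrightarrow> smooth M (pd M k e)"
  unfolding smooth_def Let_def
proof (intro allI)
  fix ks c
  assume *: "\<forall>ks c. continuous_on (chart_dom M c) (\<lambda>x. fold (pd M) ks e (c, x)) \<and>
     (\<forall>x\<in>chart_dom M c. \<forall>k. (\<lambda>t. fold (pd M) ks e (step M k t (c, x))) field_differentiable at 0)"
  show "continuous_on (chart_dom M c) (\<lambda>x. fold (pd M) ks (pd M k e) (c, x)) \<and>
     (\<forall>x\<in>chart_dom M c. \<forall>k'. (\<lambda>t. fold (pd M) ks (pd M k e) (step M k' t (c, x)))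
        field_differentiable at 0)"
    using *[rule_format, of c "k # ks"] by simp
qed

text \<open>
  Differentiability and closure under partial derivatives are proved together, since the sum and the
  product rule need the former in order to yield the latter.
\<close>

lemma coeffs_derivative:
  assumes M: "affine_manifold M" and f: "f \<in> smooth_coeffs M"
  shows coeffs_differentiable:
      "p \<in> configs M \<Longrightarrow> (\<lambda>t. f (move M \<alpha> k t p)) field_differentiable at 0"
    and coeffs_deriv: "(\<lambda>p. deriv (\<lambda>t. f (move M \<alpha> k t p)) 0) \<in> smooth_coeffs M"
proof -
  have "(\<forall>p\<in>configs M. (\<lambda>t. f (move M \<alpha> k t p)) field_differentiable at 0)
    \<and> (\<lambda>p. deriv (\<lambda>t. f (move M \<alpha> k t p)) 0) \<in> smooth_coeffs M"
    using f
  proof (induction rule: smooth_coeffs.induct)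
    case (const c)
    then show ?case by (simp add: smooth_coeffs.const)
  next
    case (pull e i)
    show ?case
    proof (cases "i = \<alpha>")
      case True
      have "(\<lambda>t. e (step M k t (p \<alpha>))) field_differentiable at 0" if "p \<in> configs M" for p
      proof -
        have pa: "p \<alpha> \<in> local_pts M" using that by (simp add: configs_def)
        obtain c x where "p \<alpha> = (c, x)" "x \<in> chart_dom M c"
          using pa by (auto simp: local_pts_def)
        then show ?thesis using pull[unfolded smooth_def, rule_format, of "[]" c] by simp
      qed
      moreover have "(\<lambda>p. deriv (\<lambda>t. e (step M k t (p \<alpha>))) 0) \<in> smooth_coeffs M"
        using smooth_coeffs.pull[OF smooth_pd[OF pull], of k \<alpha>] by (simp add: pd_def)
      ultimately show ?thesis using True by simp
    qed (simp add: smooth_coeffs.const)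
  next
    case (add f g)
    have eq: "deriv (\<lambda>t. f (move M \<alpha> k t p) + g (move M \<alpha> k t p)) 0
        = deriv (\<lambda>t. f (move M \<alpha> k t p)) 0 + deriv (\<lambda>t. g (move M \<alpha> k t p)) 0"
      if "p \<in> configs M" for p
      using add.IH that by (intro deriv_add) blast+
    have "(\<lambda>p. deriv (\<lambda>t. f (move M \<alpha> k t p) + g (move M \<alpha> k t p)) 0) \<in> smooth_coeffs M"
      by (rule smooth_coeffs.cong[OF smooth_coeffs.add[OF add.IH(1)[THEN conjunct2] add.IH(2)[THEN conjunct2]]])
         (rule eq[symmetric])
    then show ?case using add.IH field_differentiable_add by blast
  next
    case (mult f g)
    have eq: "deriv (\<lambda>t. f (move M \<alpha> k t p) * g (move M \<alpha> k t p)) 0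
        = f p * deriv (\<lambda>t. g (move M \<alpha> k t p)) 0 + deriv (\<lambda>t. f (move M \<alpha> k t p)) 0 * g p"
      if "p \<in> configs M" for p
      using mult.IH that by (subst deriv_mult) (blast, blast, simp only: move_0[OF M that])
    have "(\<lambda>p. deriv (\<lambda>t. f (move M \<alpha> k t p) * g (move M \<alpha> k t p)) 0) \<in> smooth_coeffs M"
      by (rule smooth_coeffs.cong[OF smooth_coeffs.add[OF
            smooth_coeffs.mult[OF mult.hyps(1) mult.IH(2)[THEN conjunct2]]
            smooth_coeffs.mult[OF mult.IH(1)[THEN conjunct2] mult.hyps(2)]]]) (rule eq[symmetric])
    then show ?case using mult.IH field_differentiable_mult by blast
  next
    case (cong f g)
    have ev: "\<forall>\<^sub>F t in nhds 0. f (move M \<alpha> k t p) = g (move M \<alpha> k t p)" if "p \<in> configs M" for p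
      using eventually_move[OF M that, of \<alpha> k] by eventually_elim (rule cong.hyps)
    have "(\<lambda>t. g (move M \<alpha> k t p)) field_differentiable at 0" if "p \<in> configs M" for p
      using cong.IH that DERIV_cong_ev[OF refl ev[OF that] refl]
      unfolding field_differentiable_def by blast
    moreover have "(\<lambda>p. deriv (\<lambda>t. g (move M \<alpha> k t p)) 0) \<in> smooth_coeffs M"
      by (rule smooth_coeffs.cong[OF cong.IH[THEN conjunct2]]) (rule deriv_cong_ev[OF ev refl])
    ultimately show ?case by blast
  qed
  then show "p \<in> configs M \<Longrightarrow> (\<lambda>t. f (move M \<alpha> k t p)) field_differentiable at 0"
    and "(\<lambda>p. deriv (\<lambda>t. f (move M \<alpha> k t p)) 0) \<in> smooth_coeffs M" by blast+
qed

section \<open>Total derivatives of regular densities\<close>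

text \<open>
  A finite set of words must serve all configurations at once: otherwise the coefficients of the image
  under a linear operator could be sums of unboundedly many coefficients.
\<close>

definition regular :: "('c, 'x::topological_space, 'n::finite) mfd \<Rightarrow> ('c, 'x, 'm, 'n) dens \<Rightarrow> bool" where
  "regular M h \<longleftrightarrow> (\<exists>W. finite W \<and> (\<forall>p. Poly_Mapping.keys (h p) \<subseteq> W)) \<and>
     (\<forall>w. (\<lambda>p. Poly_Mapping.lookup (h p) w) \<in> smooth_coeffs M)"

lemma regularE:
  assumes "regular M h"
  obtains W where "finite W" "\<And>p. Poly_Mapping.keys (h p) \<subseteq> W"
    "\<And>w. (\<lambda>p. Poly_Mapping.lookup (h p) w) \<in> smooth_coeffs M"
  using assms unfolding regular_def by blast

lemma regular_keysE:
  assumes "regular M h"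
  obtains W where "finite W" "\<And>p. Poly_Mapping.keys (h p) \<subseteq> W"
  using assms unfolding regular_def by meson

lemma regularI:
  assumes "finite W" "\<And>p. Poly_Mapping.keys (h p) \<subseteq> W"
    "\<And>w. (\<lambda>p. Poly_Mapping.lookup (h p) w) \<in> smooth_coeffs M"
  shows "regular M h"
  using assms unfolding regular_def by blast

lemma regular_zero: "regular M (\<lambda>p. 0)"
  by (rule regularI[of "{}"]) (auto simp: smooth_coeffs.const)

lemma regular_add:
  assumes "regular M h" "regular M h'" shows "regular M (\<lambda>p. h p + h' p)"
proof -
  obtain W where W: "finite W" "\<And>p. Poly_Mapping.keys (h p) \<subseteq> W"
    by (rule regular_keysE[OF assms(1)]) (rule that)
  obtain W' where W': "finite W'" "\<And>p. Poly_Mapping.keys (h' p) \<subseteq> W'"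
    by (rule regular_keysE[OF assms(2)]) (rule that)
  have "finite (W \<union> W')" using W(1) W'(1) by simp
  moreover have "Poly_Mapping.keys (h p + h' p) \<subseteq> W \<union> W'" for p
    using keys_add[of "h p" "h' p"] W(2) W'(2) by blast
  ultimately show ?thesis
    by (rule regularI) (use assms in \<open>auto simp: regular_def lookup_add intro: smooth_coeffs.add\<close>)
qed

lemma regular_sum: "(\<And>i. i \<in> S \<Longrightarrow> regular M (h i)) \<Longrightarrow> regular M (\<lambda>p. \<Sum>i\<in>S. h i p)"
  by (induction S rule: infinite_finite_induct) (auto intro: regular_add regular_zero)

lemma regular_lin_op:
  assumes "regular M h" "lin_op \<phi>" shows "regular M (\<lambda>p. \<phi> (h (p \<circ> r)))"
proof -
  obtain W where W: "finite W" "\<And>p. Poly_Mapping.keys (h p) \<subseteq> W"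
    "\<And>w. (\<lambda>p. Poly_Mapping.lookup (h p) w) \<in> smooth_coeffs M"
    using regularE[OF assms(1)] by blast
  show ?thesis
  proof (rule regularI)
    show "finite (\<Union>w\<in>W. Poly_Mapping.keys (\<phi> (mono w)))" using W(1) by simp
    show "Poly_Mapping.keys (\<phi> (h (p \<circ> r))) \<subseteq> (\<Union>w\<in>W. Poly_Mapping.keys (\<phi> (mono w)))" for p
      using keys_lin_op[OF assms(2), of "h (p \<circ> r)"] W(2)[of "p \<circ> r"] by blast
    show "(\<lambda>p. Poly_Mapping.lookup (\<phi> (h (p \<circ> r))) w) \<in> smooth_coeffs M" for w
      by (subst lin_op_over[OF assms(2) W(1,2)], simp only: lookup_sum lookup_scl)
         (intro coeffs_sum smooth_coeffs.mult smooth_coeffs.const coeffs_comp W(3))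
  qed
qed

lemmas regular_lin_op_id = regular_lin_op[where r = id, unfolded comp_id]

definition coeff_d ::
  "('c, 'x, 'n::finite) mfd \<Rightarrow> nat \<Rightarrow> 'n \<Rightarrow> ('c, 'x, 'm, 'n) dens \<Rightarrow> ('c, 'x, 'm, 'n) dens" where
  "coeff_d M \<alpha> k h p = (\<Sum>w. Poly_Mapping.single w
      (deriv (\<lambda>t. Poly_Mapping.lookup (h (move M \<alpha> k t p)) w) 0))"

lemma total_d_coeff_d: "total_d M \<alpha> k h p = coeff_d M \<alpha> k h p + lin_ext (shift_jet \<alpha> k) (h p)"
  by (simp add: total_d_def coeff_d_def)

lemma coeff_d_finite:
  assumes "finite W" "\<And>p. Poly_Mapping.keys (h p) \<subseteq> W"
  shows "coeff_d M \<alpha> k h p = (\<Sum>w\<in>W. Poly_Mapping.single w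
      (deriv (\<lambda>t. Poly_Mapping.lookup (h (move M \<alpha> k t p)) w) 0))"
  unfolding coeff_d_def
proof (rule Sum_any.expand_superset[OF assms(1)], rule subsetI, rule ccontr)
  fix w assume w: "w \<in> {w. Poly_Mapping.single w
      (deriv (\<lambda>t. Poly_Mapping.lookup (h (move M \<alpha> k t p)) w) 0) \<noteq> 0}" and "w \<notin> W"
  then have "Poly_Mapping.lookup (h q) w = 0" for q
    using assms(2)[of q] by (meson in_keys_iff subsetD)
  with w show False by simp
qed

lemma keys_coeff_d:
  assumes "finite W" "\<And>p. Poly_Mapping.keys (h p) \<subseteq> W"
  shows "Poly_Mapping.keys (coeff_d M \<alpha> k h p) \<subseteq> W"
  unfolding coeff_d_finite[OF assms]
  by (rule order_trans[OF Poly_Mapping.keys_sum]) auto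

lemma lookup_sum_single:
  assumes "finite W"
  shows "Poly_Mapping.lookup (\<Sum>u\<in>W. Poly_Mapping.single u (f u)) w = (if w \<in> W then f w else 0)"
  using assms by (simp add: lookup_sum lookup_single when_def)

lemma lookup_coeff_d:
  assumes "regular M h"
  shows "Poly_Mapping.lookup (coeff_d M \<alpha> k h p) w
    = deriv (\<lambda>t. Poly_Mapping.lookup (h (move M \<alpha> k t p)) w) 0"
proof -
  obtain W where W: "finite W" "\<And>p. Poly_Mapping.keys (h p) \<subseteq> W"
    by (rule regular_keysE[OF assms]) (rule that)
  have "Poly_Mapping.lookup (h q) w = 0" if "w \<notin> W" for q
    using that W(2)[of q] by (meson in_keys_iff subsetD)
  then have "(\<lambda>t. Poly_Mapping.lookup (h (move M \<alpha> k t p)) w) = (\<lambda>t. 0)" if "w \<notin> W"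
    using that by blast
  then show ?thesis
    unfolding coeff_d_finite[OF W] lookup_sum_single[OF W(1)]
    by (cases "w \<in> W") (simp_all only: if_True if_False deriv_const simp_thms)
qed

lemma regular_total_d:
  assumes M: "affine_manifold M" and h: "regular M h"
  shows "regular M (total_d M \<alpha> k h)"
proof -
  obtain W where W: "finite W" "\<And>p. Poly_Mapping.keys (h p) \<subseteq> W"
    "\<And>w. (\<lambda>p. Poly_Mapping.lookup (h p) w) \<in> smooth_coeffs M"
    using regularE[OF h] by blast
  have "regular M (coeff_d M \<alpha> k h)"
    by (rule regularI[OF W(1) keys_coeff_d[OF W(1,2)]])
       (simp add: lookup_coeff_d[OF h] coeffs_deriv[OF M W(3)])
  from regular_add[OF this regular_lin_op_id[OF h lin_op_lin_ext]] show ?thesis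
    by (simp add: total_d_coeff_d[abs_def])
qed

lemma total_d_cong:
  assumes M: "affine_manifold M" and "\<And>q. q \<in> configs M \<Longrightarrow> h q = h' q" "p \<in> configs M"
  shows "total_d M \<alpha> k h p = total_d M \<alpha> k h' p"
proof -
  have "\<forall>\<^sub>F t in nhds 0. Poly_Mapping.lookup (h (move M \<alpha> k t p)) w
      = Poly_Mapping.lookup (h' (move M \<alpha> k t p)) w" for w
    using eventually_move[OF M assms(3), of \<alpha> k] by eventually_elim (simp only: assms(2))
  from deriv_cong_ev[OF this refl] show ?thesis
    by (simp add: total_d_def assms(2,3))
qed

lemma total_d_add:
  assumes M: "affine_manifold M" and h: "regular M h" "regular M h'" and p: "p \<in> configs M"
  shows "total_d M \<alpha> k (\<lambda>q. h q + h' q) p = total_d M \<alpha> k h p + total_d M \<alpha> k h' p"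
proof -
  have "coeff_d M \<alpha> k (\<lambda>q. h q + h' q) p = coeff_d M \<alpha> k h p + coeff_d M \<alpha> k h' p"
  proof (rule poly_mapping_eqI)
    fix w
    have "(\<lambda>t. Poly_Mapping.lookup (h (move M \<alpha> k t p)) w) field_differentiable at 0"
      "(\<lambda>t. Poly_Mapping.lookup (h' (move M \<alpha> k t p)) w) field_differentiable at 0"
      using h by (auto intro: coeffs_differentiable[OF M _ p, where f = "\<lambda>p. Poly_Mapping.lookup (_ p) w"]
          simp: regular_def)
    then show "Poly_Mapping.lookup (coeff_d M \<alpha> k (\<lambda>q. h q + h' q) p) w
      = Poly_Mapping.lookup (coeff_d M \<alpha> k h p + coeff_d M \<alpha> k h' p) w"
      by (simp add: lookup_coeff_d h regular_add lookup_add)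
  qed
  then show ?thesis by (simp add: total_d_coeff_d lin_op_add[OF lin_op_lin_ext])
qed

text \<open>
  The one commutation rule from which all invariance properties of total derivatives follow: it is used
  for renamings of the copies (with \<open>\<phi> = ren r\<close>), for multiplication by scalars and for \<open>\<phi> x = x - rot x\<close>
  (with \<open>r = id\<close>). Injectivity of \<open>r\<close> guarantees that moving the point of the copy \<open>r \<alpha>\<close> moves the point
  of the copy \<open>\<alpha>\<close> only.
\<close>

lemma total_d_intertwine:
  assumes M: "affine_manifold M" and \<phi>: "lin_op \<phi>" and "inj r"
    and shift: "\<And>x. lin_ext (shift_jet (r \<alpha>) k) (\<phi> x) = \<phi> (lin_ext (shift_jet \<alpha> k) x)"
    and h: "regular M h" and p: "p \<in> configs M"
  shows "total_d M (r \<alpha>) k (\<lambda>q. \<phi> (h (q \<circ> r))) p = \<phi> (total_d M \<alpha> k h (p \<circ> r))"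
proof -
  obtain W where W: "finite W" "\<And>p. Poly_Mapping.keys (h p) \<subseteq> W"
    "\<And>w. (\<lambda>p. Poly_Mapping.lookup (h p) w) \<in> smooth_coeffs M"
    using regularE[OF h] by blast
  have mv: "move M (r \<alpha>) k t p \<circ> r = move M \<alpha> k t (p \<circ> r)" for t
    using inj_eq[OF \<open>inj r\<close>] by auto
  have "coeff_d M (r \<alpha>) k (\<lambda>q. \<phi> (h (q \<circ> r))) p = \<phi> (coeff_d M \<alpha> k h (p \<circ> r))"
  proof (rule poly_mapping_eqI)
    fix w
    let ?c = "\<lambda>u. Poly_Mapping.lookup (\<phi> (mono u)) w"
    have "((\<lambda>t. Poly_Mapping.lookup (h (move M \<alpha> k t (p \<circ> r))) u) has_field_derivative
        Poly_Mapping.lookup (coeff_d M \<alpha> k h (p \<circ> r)) u) (at 0)" for u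
      unfolding lookup_coeff_d[OF h] using coeffs_differentiable[OF M W(3) configs_comp[OF p]]
      by (simp only: DERIV_deriv_iff_field_differentiable)
    then have "((\<lambda>t. \<Sum>u\<in>W. Poly_Mapping.lookup (h (move M \<alpha> k t (p \<circ> r))) u * ?c u)
        has_field_derivative (\<Sum>u\<in>W. Poly_Mapping.lookup (coeff_d M \<alpha> k h (p \<circ> r)) u * ?c u)) (at 0)"
      by (intro DERIV_sum DERIV_cmult_right)
    moreover have "Poly_Mapping.lookup (\<phi> (h q)) w = (\<Sum>u\<in>W. Poly_Mapping.lookup (h q) u * ?c u)" for q
      by (subst lin_op_over[OF \<phi> W(1,2)]) (simp add: lookup_sum)
    moreover have "Poly_Mapping.lookup (\<phi> (coeff_d M \<alpha> k h (p \<circ> r))) w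
        = (\<Sum>u\<in>W. Poly_Mapping.lookup (coeff_d M \<alpha> k h (p \<circ> r)) u * ?c u)"
      by (subst lin_op_over[OF \<phi> W(1) keys_coeff_d[OF W(1,2)]]) (simp add: lookup_sum)
    ultimately show "Poly_Mapping.lookup (coeff_d M (r \<alpha>) k (\<lambda>q. \<phi> (h (q \<circ> r))) p) w
        = Poly_Mapping.lookup (\<phi> (coeff_d M \<alpha> k h (p \<circ> r))) w"
      by (simp only: lookup_coeff_d[OF regular_lin_op[OF h \<phi>]] mv DERIV_imp_deriv)
  qed
  then show ?thesis by (simp add: total_d_coeff_d shift lin_op_add[OF \<phi>])
qed

lemma total_d_zero: "total_d M \<alpha> k (\<lambda>q. 0) = (\<lambda>q. 0)"
  by (rule ext) (simp add: total_d_def lin_op_zero[OF lin_op_lin_ext])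

text \<open>
  A step of the fold is evaluated at nearby configurations by the next one; therefore the hypothesis
  is an equality at all configurations.
\<close>

lemma fold_total_d_cong:
  assumes M: "affine_manifold M" and "\<And>q. q \<in> configs M \<Longrightarrow> h q = h' q" "p \<in> configs M"
  shows "fold (\<lambda>k h. - total_d M \<alpha> k h) ks h p = fold (\<lambda>k h. - total_d M \<alpha> k h) ks h' p"
  using assms(2)
proof (induction ks arbitrary: h h')
  case (Cons k ks)
  have step: "(- total_d M \<alpha> k h) q = (- total_d M \<alpha> k h') q" if "q \<in> configs M" for q
    using total_d_cong[OF M Cons.prems that] by (simp add: fun_Compl_def)
  show ?case
    unfolding fold.simps o_apply by (rule Cons.IH) (rule step)
qed (simp add: assms(3))

lemma minus_d_pow_cong:
  assumes "affine_manifold M" and "\<And>q. q \<in> configs M \<Longrightarrow> h q = h' q" "p \<in> configs M"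
  shows "minus_d_pow M \<alpha> \<sigma> h p = minus_d_pow M \<alpha> \<sigma> h' p"
  unfolding minus_d_pow_def using assms by (rule fold_total_d_cong)

lemma regular_minus_total_d:
  assumes "affine_manifold M" "regular M h" shows "regular M (- total_d M \<alpha> k h)"
  using regular_lin_op_id[OF regular_total_d[OF assms, of \<alpha> k] lin_op_scl[of "-1"]]
  by (simp add: scl_distribs fun_Compl_def)

lemma minus_d_pow_regular:
  assumes "affine_manifold M" "regular M h"
  shows "regular M (minus_d_pow M \<alpha> \<sigma> h)"
proof -
  have "regular M (fold (\<lambda>k h. - total_d M \<alpha> k h) ks h)" for ks
    using assms(2) by (induction ks arbitrary: h) (simp_all add: regular_minus_total_d[OF assms(1)])
  then show ?thesis by (simp add: minus_d_pow_def)
qed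

lemma minus_d_pow_add:
  assumes M: "affine_manifold M" and h: "regular M h" "regular M h'" and p: "p \<in> configs M"
  shows "minus_d_pow M \<alpha> \<sigma> (\<lambda>q. h q + h' q) p = minus_d_pow M \<alpha> \<sigma> h p + minus_d_pow M \<alpha> \<sigma> h' p"
proof -
  have "fold (\<lambda>k h. - total_d M \<alpha> k h) ks (\<lambda>q. h q + h' q) p
    = fold (\<lambda>k h. - total_d M \<alpha> k h) ks h p + fold (\<lambda>k h. - total_d M \<alpha> k h) ks h' p" for ks
    using h
  proof (induction ks arbitrary: h h')
    case (Cons k ks)
    let ?T = "\<lambda>h. - total_d M \<alpha> k h"
    have "fold (\<lambda>k h. - total_d M \<alpha> k h) ks (?T (\<lambda>q. h q + h' q)) p
      = fold (\<lambda>k h. - total_d M \<alpha> k h) ks (\<lambda>q. ?T h q + ?T h' q) p"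
      by (rule fold_total_d_cong[OF M _ p])
         (simp add: total_d_add[OF M Cons.prems] fun_Compl_def)
    also note Cons.IH[OF regular_minus_total_d[OF M Cons.prems(1)]
      regular_minus_total_d[OF M Cons.prems(2)]]
    finally show ?case by (simp only: fold.simps o_apply[of "fold _ _"])
  qed simp
  then show ?thesis by (simp add: minus_d_pow_def)
qed

lemma minus_d_pow_intertwine:
  assumes M: "affine_manifold M" and \<phi>: "lin_op \<phi>" and "inj r"
    and shift: "\<And>k x. lin_ext (shift_jet (r \<alpha>) k) (\<phi> x) = \<phi> (lin_ext (shift_jet \<alpha> k) x)"
    and h: "regular M h" and p: "p \<in> configs M"
  shows "minus_d_pow M (r \<alpha>) \<sigma> (\<lambda>q. \<phi> (h (q \<circ> r))) p = \<phi> (minus_d_pow M \<alpha> \<sigma> h (p \<circ> r))"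
proof -
  have "fold (\<lambda>k h. - total_d M (r \<alpha>) k h) ks (\<lambda>q. \<phi> (h (q \<circ> r))) p
    = \<phi> (fold (\<lambda>k h. - total_d M \<alpha> k h) ks h (p \<circ> r))" for ks
    using h
  proof (induction ks arbitrary: h)
    case (Cons k ks)
    have "fold (\<lambda>k h. - total_d M (r \<alpha>) k h) ks (- total_d M (r \<alpha>) k (\<lambda>q. \<phi> (h (q \<circ> r)))) p
      = fold (\<lambda>k h. - total_d M (r \<alpha>) k h) ks (\<lambda>q. \<phi> ((- total_d M \<alpha> k h) (q \<circ> r))) p"
      by (rule fold_total_d_cong[OF M _ p])
         (simp add: total_d_intertwine[OF M \<phi> \<open>inj r\<close> shift Cons.prems] lin_op_minus[OF \<phi>])
    also note Cons.IH[OF regular_minus_total_d[OF M Cons.prems]]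
    finally show ?case by (simp only: fold.simps o_apply[of "fold _ _"])
  qed simp
  then show ?thesis by (simp add: minus_d_pow_def)
qed

lemma minus_d_pow_lin_op:
  assumes "affine_manifold M" "lin_op \<phi>"
    and "\<And>k x. lin_ext (shift_jet \<alpha> k) (\<phi> x) = \<phi> (lin_ext (shift_jet \<alpha> k) x)"
    and "regular M h" "p \<in> configs M"
  shows "minus_d_pow M \<alpha> \<sigma> (\<lambda>q. \<phi> (h q)) p = \<phi> (minus_d_pow M \<alpha> \<sigma> h p)"
  by (rule minus_d_pow_intertwine[where r = id, unfolded comp_id id_apply, OF assms(1,2) _ assms(3-5)])
     (simp add: inj_on_def)

lemma minus_d_pow_zero: "minus_d_pow M \<alpha> \<sigma> (\<lambda>q. 0) = (\<lambda>q. 0)"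
proof -
  have "fold (\<lambda>k h. - total_d M \<alpha> k h) ks (\<lambda>q. 0) = (\<lambda>q. 0)" for ks
    by (induction ks) (simp_all add: total_d_zero fun_Compl_def)
  then show ?thesis by (simp add: minus_d_pow_def)
qed


section \<open>The summands of the Laplacian\<close>

lemma set_del_letter:
  assumes "w \<in> Poly_Mapping.keys (lin_ext (del_letter l) x)"
  obtains u where "u \<in> Poly_Mapping.keys x" "set w \<subseteq> set u"
proof -
  obtain u where u: "u \<in> Poly_Mapping.keys x" "w \<in> Poly_Mapping.keys (del_letter l u)"
    using keys_lin_op[OF lin_op_lin_ext, of "del_letter l" x] assms by auto
  have "Poly_Mapping.keys (del_letter l u) \<subseteq> (\<lambda>\<nu>. take \<nu> u @ drop (Suc \<nu>) u) ` UNIV"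
    unfolding del_letter_def by (rule order_trans[OF Poly_Mapping.keys_sum]) auto
  then obtain \<nu> where "w = take \<nu> u @ drop (Suc \<nu>) u" using u(2) by blast
  then have "set w \<subseteq> set u" by (auto dest: in_set_takeD in_set_dropD)
  with u(1) show ?thesis by (rule that)
qed

lemma del_letter_absent:
  assumes "\<And>w. w \<in> Poly_Mapping.keys x \<Longrightarrow> l \<notin> set w"
  shows "lin_ext (del_letter l) x = 0"
proof -
  have "del_letter l w = 0" if "w \<in> Poly_Mapping.keys x" for w
    using assms[OF that] by (auto simp: del_letter_def intro!: sum.neutral)
  then show ?thesis by (simp add: lin_ext_def)
qed

definition laplace_summand ::
  "('c, 'x, 'n::finite) mfd \<Rightarrow> nat \<Rightarrow> nat \<Rightarrow> 'm \<Rightarrow> 'n multiset \<times> 'n multiset \<Rightarrow>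
    ('c, 'x, 'm::finite, 'n) dens \<Rightarrow> ('c, 'x, 'm, 'n) dens" where
  "laplace_summand M \<alpha> \<beta> i st h =
     minus_d_pow M \<alpha> (fst st) (minus_d_pow M \<beta> (snd st)
       (\<lambda>q. lin_ext (del_letter (\<alpha>, Ev i (fst st))) (lin_ext (del_letter (\<beta>, Od i (snd st))) (h q))))"

lemma laplace_term_summand:
  "laplace_term M \<alpha> \<beta> h p = (\<Sum>i\<in>UNIV. Sum_any (\<lambda>st. laplace_summand M \<alpha> \<beta> i st h p))"
  by (simp add: laplace_term_def laplace_summand_def case_prod_unfold)

text \<open>
  Only the finitely many jet indices which occur in the words of \<open>h\<close> contribute. This is what allows
  to split the sum over all multi-indices, which by convention is \<open>0\<close> if its support is infinite.
\<close>

lemma finite_laplace_summand: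
  assumes "regular M h"
  shows "finite {st. laplace_summand M \<alpha> \<beta> i st h p \<noteq> 0}"
proof -
  obtain W where W: "finite W" "\<And>p. Poly_Mapping.keys (h p) \<subseteq> W"
    by (rule regular_keysE[OF assms]) (rule that)
  let ?J = "(\<lambda>x. jet (snd x)) ` (\<Union>w\<in>W. set w)"
  have "laplace_summand M \<alpha> \<beta> i st h p = 0" if st: "st \<notin> ?J \<times> ?J" for st
  proof -
    have a: "(\<alpha>, l) \<notin> set w" if "w \<in> Poly_Mapping.keys (h q)" "jet l \<notin> ?J" for \<alpha> l w q
      using that W(2)[of q] by force
    have "lin_ext (del_letter (\<alpha>, Ev i (fst st))) (lin_ext (del_letter (\<beta>, Od i (snd st))) (h q)) = 0"
      for q
    proof (cases "snd st \<in> ?J")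
      case True
      then have s: "jet (Ev i (fst st)) \<notin> ?J" using st by (cases st) auto
      show ?thesis
        by (rule del_letter_absent) (use a[OF _ s] set_del_letter in blast)
    next
      case False
      then have "lin_ext (del_letter (\<beta>, Od i (snd st))) (h q) = 0"
        by (intro del_letter_absent a) auto
      then show ?thesis by (simp add: lin_op_zero[OF lin_op_lin_ext])
    qed
    then show ?thesis by (simp add: laplace_summand_def minus_d_pow_zero)
  qed
  then have "{st. laplace_summand M \<alpha> \<beta> i st h p \<noteq> 0} \<subseteq> ?J \<times> ?J" by blast
  then show ?thesis by (rule finite_subset) (use W(1) in simp)
qed

lemma lin_op_Sum_any:
  assumes "lin_op \<phi>" "finite {i. f i \<noteq> 0}"
  shows "\<phi> (Sum_any f) = Sum_any (\<lambda>i. \<phi> (f i))"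
proof -
  have "Sum_any (\<lambda>i. \<phi> (f i)) = (\<Sum>i\<in>{i. f i \<noteq> 0}. \<phi> (f i))"
    using assms(2) by (rule Sum_any.expand_superset) (auto simp: lin_op_zero[OF assms(1)])
  then show ?thesis by (simp add: Sum_any.expand_set lin_op_sum[OF assms(1)])
qed

lemma laplace_term_add:
  assumes M: "affine_manifold M" and h: "regular M h" "regular M h'" and p: "p \<in> configs M"
  shows "laplace_term M \<alpha> \<beta> (\<lambda>q. h q + h' q) p = laplace_term M \<alpha> \<beta> h p + laplace_term M \<alpha> \<beta> h' p"
proof -
  have "laplace_summand M \<alpha> \<beta> i st (\<lambda>q. h q + h' q) p
    = laplace_summand M \<alpha> \<beta> i st h p + laplace_summand M \<alpha> \<beta> i st h' p" for i st
  proof -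
    let ?d = "\<lambda>x. lin_ext (del_letter (\<alpha>, Ev i (fst st))) (lin_ext (del_letter (\<beta>, Od i (snd st))) x)"
    let ?D = "minus_d_pow M \<beta> (snd st)"
    have l: "lin_op ?d" by (rule lin_op_comp[OF lin_op_lin_ext lin_op_lin_ext])
    note r = regular_lin_op_id[OF h(1) l] regular_lin_op_id[OF h(2) l]
    have "minus_d_pow M \<alpha> (fst st) (?D (\<lambda>q. ?d (h q + h' q))) p
      = minus_d_pow M \<alpha> (fst st) (\<lambda>q. ?D (\<lambda>q. ?d (h q)) q + ?D (\<lambda>q. ?d (h' q)) q) p"
      by (rule minus_d_pow_cong[OF M _ p])
         (simp add: lin_op_add[OF l] minus_d_pow_add[OF M r])
    also have "\<dots> = minus_d_pow M \<alpha> (fst st) (?D (\<lambda>q. ?d (h q))) p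
        + minus_d_pow M \<alpha> (fst st) (?D (\<lambda>q. ?d (h' q))) p"
      by (rule minus_d_pow_add[OF M minus_d_pow_regular[OF M r(1)] minus_d_pow_regular[OF M r(2)] p])
    finally show ?thesis by (simp add: laplace_summand_def)
  qed
  then show ?thesis
    by (simp add: laplace_term_summand Sum_any.distrib finite_laplace_summand h sum.distrib)
qed

lemma laplace_term_intertwine:
  assumes M: "affine_manifold M" and \<phi>: "lin_op \<phi>" and "inj r"
    and shift: "\<And>\<alpha> k x. lin_ext (shift_jet (r \<alpha>) k) (\<phi> x) = \<phi> (lin_ext (shift_jet \<alpha> k) x)"
    and del: "\<And>\<alpha> l x. lin_ext (del_letter (r \<alpha>, l)) (\<phi> x) = \<phi> (lin_ext (del_letter (\<alpha>, l)) x)"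
    and h: "regular M h" and p: "p \<in> configs M"
  shows "laplace_term M (r \<alpha>) (r \<beta>) (\<lambda>q. \<phi> (h (q \<circ> r))) p = \<phi> (laplace_term M \<alpha> \<beta> h (p \<circ> r))"
proof -
  have "laplace_summand M (r \<alpha>) (r \<beta>) i st (\<lambda>q. \<phi> (h (q \<circ> r))) p
    = \<phi> (laplace_summand M \<alpha> \<beta> i st h (p \<circ> r))" for i st
  proof -
    let ?d = "\<lambda>x. lin_ext (del_letter (\<alpha>, Ev i (fst st))) (lin_ext (del_letter (\<beta>, Od i (snd st))) x)"
    note r = regular_lin_op_id[OF h lin_op_comp[OF lin_op_lin_ext lin_op_lin_ext],
      of "del_letter (\<alpha>, Ev i (fst st))" "del_letter (\<beta>, Od i (snd st))"]
    have "minus_d_pow M (r \<alpha>) (fst st) (minus_d_pow M (r \<beta>) (snd st) (\<lambda>q. \<phi> (?d (h (q \<circ> r))))) p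
      = minus_d_pow M (r \<alpha>) (fst st) (\<lambda>q. \<phi> (minus_d_pow M \<beta> (snd st) (\<lambda>q. ?d (h q)) (q \<circ> r))) p"
      by (rule minus_d_pow_cong[OF M minus_d_pow_intertwine[OF M \<phi> \<open>inj r\<close> shift r] p])
    also have "\<dots> = \<phi> (minus_d_pow M \<alpha> (fst st) (minus_d_pow M \<beta> (snd st) (\<lambda>q. ?d (h q))) (p \<circ> r))"
      by (rule minus_d_pow_intertwine[OF M \<phi> \<open>inj r\<close> shift minus_d_pow_regular[OF M r] p])
    finally show ?thesis by (simp add: laplace_summand_def del)
  qed
  then show ?thesis
    by (simp add: laplace_term_summand lin_op_Sum_any[OF \<phi>] finite_laplace_summand h lin_op_sum[OF \<phi>])
qed

lemma laplace_term_scl: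
  assumes "affine_manifold M" "regular M h" "p \<in> configs M"
  shows "laplace_term M \<alpha> \<beta> (\<lambda>q. scl c (h q)) p = scl c (laplace_term M \<alpha> \<beta> h p)"
  using laplace_term_intertwine[OF assms(1) lin_op_scl inj_on_id _ _ assms(2,3), of c \<alpha> \<beta>]
  by (simp add: lin_op_scale[OF lin_op_lin_ext])

lemma laplace_term_relabel:
  assumes "affine_manifold M" "inj r" "regular M h" "p \<in> configs M"
  shows "laplace_term M (r \<alpha>) (r \<beta>) (relabel r h) p = relabel r (laplace_term M \<alpha> \<beta> h) p"
  using laplace_term_intertwine[OF assms(1) lin_op_ren assms(2) shift_ren del_ren assms(3,4), OF assms(2,2)]
  by (simp add: relabel_ren[abs_def])

text \<open>
  By \<open>del_diff_rot\<close>, the two deletions turn \<open>g - rot g\<close> into \<open>g' - rot g'\<close>, where \<open>g'\<close> arises from \<open>g\<close> by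
  two deletions away from the last position. Total derivatives commute with \<open>x \<mapsto> x - rot x\<close>, so this
  form persists.
\<close>

lemma laplace_term_cyc_null:
  assumes M: "affine_manifold M" and g: "regular M g" and p: "p \<in> configs M"
  shows "laplace_term M \<alpha> \<beta> (\<lambda>q. g q - rot (g q)) p \<in> cyc_null"
proof -
  have "laplace_summand M \<alpha> \<beta> i st (\<lambda>q. g q - rot (g q)) p \<in> cyc_null" for i st
  proof -
    let ?d = "\<lambda>x. lin_ext (del_init (\<alpha>, Ev i (fst st))) (lin_ext (del_init (\<beta>, Od i (snd st))) x)"
    let ?D = "minus_d_pow M \<beta> (snd st)" and ?\<phi> = "\<lambda>x. x - rot x"
    have l: "lin_op ?d" by (rule lin_op_comp[OF lin_op_lin_ext lin_op_lin_ext])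
    note r = regular_lin_op_id[OF g l]
    have \<phi>: "lin_op ?\<phi>" by (rule lin_op_diff_op[OF lin_op_id lin_op_rot])
    have shift: "lin_ext (shift_jet \<alpha> k) (x - rot x) = lin_ext (shift_jet \<alpha> k) x - rot (lin_ext (shift_jet \<alpha> k) x)"
      for \<alpha> k and x :: "('d, 'c) ncpoly"
      by (simp add: lin_op_diff[OF lin_op_lin_ext] shift_rot)
    have "laplace_summand M \<alpha> \<beta> i st (\<lambda>q. ?\<phi> (g q)) p
        = minus_d_pow M \<alpha> (fst st) (?D (\<lambda>q. ?\<phi> (?d (g q)))) p"
      by (simp add: laplace_summand_def del_diff_rot)
    also have "\<dots> = minus_d_pow M \<alpha> (fst st) (\<lambda>q. ?\<phi> (?D (\<lambda>q. ?d (g q)) q)) p"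
      by (rule minus_d_pow_cong[OF M minus_d_pow_lin_op[OF M \<phi> shift r] p])
    also have "\<dots> = ?\<phi> (minus_d_pow M \<alpha> (fst st) (?D (\<lambda>q. ?d (g q))) p)"
      by (rule minus_d_pow_lin_op[OF M \<phi> shift minus_d_pow_regular[OF M r] p])
    finally show ?thesis by (simp only: cyc_nullI)
  qed
  then show ?thesis by (auto simp: laplace_term_summand intro!: cyc_null_sum cyc_null_Sum_any)
qed

lemma laplace_term_zero: "laplace_term M \<alpha> \<beta> (\<lambda>q. 0) p = 0"
  by (simp add: laplace_term_summand laplace_summand_def lin_op_zero[OF lin_op_lin_ext] minus_d_pow_zero)

lemma laplace_term_sum:
  assumes M: "affine_manifold M" and p: "p \<in> configs M" and "\<And>i. i \<in> S \<Longrightarrow> regular M (h i)"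
  shows "laplace_term M \<alpha> \<beta> (\<lambda>q. \<Sum>i\<in>S. h i q) p = (\<Sum>i\<in>S. laplace_term M \<alpha> \<beta> (h i) p)"
  using assms(3)
proof (induction S rule: infinite_finite_induct)
  case (insert i S)
  then show ?case
    by (simp add: laplace_term_add[OF M _ regular_sum p])
qed (simp_all add: laplace_term_zero)

section \<open>Exchanging the factors of a product\<close>

text \<open>
  Besides regularity, a density over \<open>L\<close> copies has letters from these copies only and ignores the points
  of all other copies. These two properties make the exchange of blocks of copies harmless.
\<close>

definition tame :: "('c, 'x::topological_space, 'n::finite) mfd \<Rightarrow> nat \<Rightarrow> ('c, 'x, 'm, 'n) dens \<Rightarrow> bool" where
  "tame M L h \<longleftrightarrow> regular M h \<and> (\<forall>p. \<forall>w\<in>Poly_Mapping.keys (h p). \<forall>l\<in>set w. fst l < L) \<and>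
     (\<forall>p p'. (\<forall>i<L. p i = p' i) \<longrightarrow> h p = h p')"

lemma lin_op_add_op: "lin_op \<phi> \<Longrightarrow> lin_op \<psi> \<Longrightarrow> lin_op (\<lambda>x. \<phi> x + \<psi> x)"
  by (simp add: lin_op_def scl_distribs)

lemma ren_cong:
  assumes "\<And>w l. w \<in> Poly_Mapping.keys x \<Longrightarrow> l \<in> set w \<Longrightarrow> r (fst l) = s (fst l)"
  shows "ren r x = ren s x"
proof (rule lin_op_eq_on[OF lin_op_ren lin_op_ren])
  fix w assume "w \<in> Poly_Mapping.keys x"
  then have "map (map_prod r id) w = map (map_prod s id) w"
    using assms by (auto simp: map_prod_def case_prod_beta)
  then show "ren r (mono w) = ren s (mono w)" by (simp only: ren_mono)
qed

lemma ren_id: "ren id x = x"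
  by (rule lin_op_eqI[OF lin_op_ren lin_op_id]) (simp add: map_prod.id)

text \<open>
  The choice of \<open>Z\<close> is made for pairs of words, before \<open>x\<close> and \<open>y\<close> are given. So if \<open>x\<close> and \<open>y\<close> depend on
  a configuration, the correction term depends on it through their coefficients, i.e. smoothly.
\<close>

lemma cyc_times_swap:
  obtains Z :: "('m, 'n) word \<Rightarrow> ('m, 'n) word \<Rightarrow> ('m, 'n) ncpoly" where
    "\<And>x y d e. \<forall>w\<in>Poly_Mapping.keys x. wdeg w = d \<Longrightarrow> \<forall>w\<in>Poly_Mapping.keys y. wdeg w = e \<Longrightarrow>
      cyc_times x y = scl ((-1) ^ (d * e)) (cyc_times y x) + (bilin_ext Z x y - rot (bilin_ext Z x y))"
proof -
  have "\<exists>z. word_times u v - scl ((-1) ^ (wdeg u * wdeg v)) (word_times v u) = z - rot z"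
    for u v :: "('m, 'n) word"
    using word_times_swap[of u v] by (simp only: cyc_null_def image_iff bex_UNIV)
  then obtain Z where Z: "\<And>u v :: ('m, 'n) word.
      word_times u v - scl ((-1) ^ (wdeg u * wdeg v)) (word_times v u) = Z u v - rot (Z u v)"
    by metis
  show ?thesis
  proof (rule that)
    fix x y :: "('m, 'n) ncpoly" and d e
    assume d: "\<forall>w\<in>Poly_Mapping.keys x. wdeg w = d" and e: "\<forall>w\<in>Poly_Mapping.keys y. wdeg w = e"
    let ?\<psi> = "\<lambda>x y. scl ((-1) ^ (d * e)) (cyc_times y x) + (bilin_ext Z x y - rot (bilin_ext Z x y))"
    have 1: "lin_op (\<lambda>y. ?\<psi> x y)" for x
      by (rule lin_op_add_op[OF lin_op_comp[OF lin_op_scl lin_op_cyc_times(1)]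
          lin_op_diff_op[OF lin_op_bilin_right lin_op_comp[OF lin_op_rot lin_op_bilin_right]]])
    have 2: "lin_op (\<lambda>x. ?\<psi> x y)" for y
      by (rule lin_op_add_op[OF lin_op_comp[OF lin_op_scl lin_op_cyc_times(2)]
          lin_op_diff_op[OF lin_op_bilin_left lin_op_comp[OF lin_op_rot lin_op_bilin_left]]])
    show "cyc_times x y = ?\<psi> x y"
    proof (rule bilin_eq_on[where \<phi> = cyc_times and \<psi> = ?\<psi>, OF lin_op_cyc_times(2) lin_op_cyc_times(1) 1 2])
      fix u v assume "u \<in> Poly_Mapping.keys x" "v \<in> Poly_Mapping.keys y"
      with d e have "wdeg u = d" "wdeg v = e" by auto
      with Z[of u v] show "cyc_times (mono u) (mono v) = ?\<psi> (mono u) (mono v)"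
        by (simp add: cyc_times_mono algebra_simps)
    qed
  qed
qed

lemma bilin_ext_over:
  assumes "finite U" "Poly_Mapping.keys x \<subseteq> U" "finite V" "Poly_Mapping.keys y \<subseteq> V"
  shows "bilin_ext B x y = (\<Sum>u\<in>U. \<Sum>v\<in>V.
    scl (Poly_Mapping.lookup x u * Poly_Mapping.lookup y v) (B u v))"
  unfolding bilin_ext_def
  by (simp add: lin_ext_over[OF assms(1,2)] lin_ext_over[OF assms(3,4)] scl_sum)

lemma regular_bilin:
  assumes "regular M h" "regular M h'" shows "regular M (\<lambda>p. bilin_ext B (h p) (h' p))"
proof -
  obtain U where U: "finite U" "\<And>p. Poly_Mapping.keys (h p) \<subseteq> U"
    "\<And>w. (\<lambda>p. Poly_Mapping.lookup (h p) w) \<in> smooth_coeffs M"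
    using regularE[OF assms(1)] by blast
  obtain V where V: "finite V" "\<And>p. Poly_Mapping.keys (h' p) \<subseteq> V"
    "\<And>w. (\<lambda>p. Poly_Mapping.lookup (h' p) w) \<in> smooth_coeffs M"
    using regularE[OF assms(2)] by blast
  note ex = bilin_ext_over[OF U(1,2) V(1,2)]
  show ?thesis
  proof (rule regularI)
    show "finite (\<Union>u\<in>U. \<Union>v\<in>V. Poly_Mapping.keys (B u v))" using U(1) V(1) by simp
    show "Poly_Mapping.keys (bilin_ext B (h p) (h' p)) \<subseteq> (\<Union>u\<in>U. \<Union>v\<in>V. Poly_Mapping.keys (B u v))" for p
    proof
      fix w assume "w \<in> Poly_Mapping.keys (bilin_ext B (h p) (h' p))"
      then have "(\<Sum>u\<in>U. \<Sum>v\<in>V. Poly_Mapping.lookup (h p) u * Poly_Mapping.lookup (h' p) v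
          * Poly_Mapping.lookup (B u v) w) \<noteq> 0"
        by (simp add: in_keys_iff ex lookup_sum)
      then show "w \<in> (\<Union>u\<in>U. \<Union>v\<in>V. Poly_Mapping.keys (B u v))"
        by (rule contrapos_np) (auto intro!: sum.neutral simp: in_keys_iff)
    qed
    show "(\<lambda>p. Poly_Mapping.lookup (bilin_ext B (h p) (h' p)) w) \<in> smooth_coeffs M" for w
      unfolding ex lookup_sum lookup_scl by (intro coeffs_sum smooth_coeffs.mult smooth_coeffs.const U(3) V(3))
  qed
qed

lemma regular_relabel: "regular M h \<Longrightarrow> regular M (relabel r h)"
  unfolding relabel_ren[abs_def] by (rule regular_lin_op[OF _ lin_op_ren])

lemma regular_dens_times: "regular M f \<Longrightarrow> regular M g \<Longrightarrow> regular M (dens_times k f g)"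
  unfolding dens_times_def[abs_def] cyc_times_def by (intro regular_bilin regular_relabel)

definition block_swap :: "nat \<Rightarrow> nat \<Rightarrow> nat \<Rightarrow> nat" where
  "block_swap l k \<gamma> = (if \<gamma> < l then \<gamma> + k else if \<gamma> < l + k then \<gamma> - l else \<gamma>)"

lemma block_swap_permutes: "block_swap l k permutes {..<k + l}"
proof (rule bij_imp_permutes)
  show "bij_betw (block_swap l k) {..<k + l} {..<k + l}"
    by (rule bij_betw_byWitness[where f' = "block_swap k l"]) (auto simp: block_swap_def)
qed (auto simp: block_swap_def)

text \<open>
  In \<open>F \<times> G\<close> the copies of \<open>F\<close> come first, in \<open>G \<times> F\<close> those of \<open>G\<close>. After \<open>block_swap l k\<close> the letters of
  both products carry the same labels and are evaluated at the same points, and the products of words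
  differ by rotations.
\<close>

lemma dens_times_swap:
  fixes M :: "('c, 'x::topological_space, 'n::finite) mfd" and f g :: "('c, 'x, 'm, 'n) dens"
  assumes f: "tame M k f" "\<forall>p. \<forall>w\<in>Poly_Mapping.keys (f p). wdeg w = d"
    and g: "tame M l g" "\<forall>p. \<forall>w\<in>Poly_Mapping.keys (g p). wdeg w = e"
  obtains z where "regular M z"
    "\<And>p. dens_times k f g p
      = scl ((-1) ^ (d * e)) (relabel (block_swap l k) (dens_times l g f) p) + (z p - rot (z p))"
proof -
  obtain Z :: "('m, 'n) word \<Rightarrow> ('m, 'n) word \<Rightarrow> ('m, 'n) ncpoly" where Z: "\<And>x y d e.
      \<forall>w\<in>Poly_Mapping.keys x. wdeg w = d \<Longrightarrow> \<forall>w\<in>Poly_Mapping.keys y. wdeg w = e \<Longrightarrow>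
      cyc_times x y = scl ((-1) ^ (d * e)) (cyc_times y x) + (bilin_ext Z x y - rot (bilin_ext Z x y))"
    by (rule cyc_times_swap) (rule that)
  let ?G = "relabel (\<lambda>\<gamma>. \<gamma> + k) g" and ?\<pi> = "block_swap l k"
  let ?z = "\<lambda>p. bilin_ext Z (f p) (?G p)"
  show ?thesis
  proof (rule that)
    show "regular M ?z"
      using f(1) g(1) by (intro regular_bilin regular_relabel) (auto simp: tame_def)
    fix p
    have e: "\<forall>w\<in>Poly_Mapping.keys (?G p). wdeg w = e"
    proof
      fix w assume w: "w \<in> Poly_Mapping.keys (?G p)"
      obtain u where "u \<in> Poly_Mapping.keys (g (p \<circ> (\<lambda>\<gamma>. \<gamma> + k)))"
        "w = map (map_prod (\<lambda>\<gamma>. \<gamma> + k) id) u"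
        using subsetD[OF keys_lin_op[OF lin_op_ren] w[unfolded relabel_ren]] by auto
      then show "wdeg w = e" using g(2) by simp
    qed
    have "ren ?\<pi> (g (p \<circ> ?\<pi>)) = ?G p"
    proof -
      have "g (p \<circ> ?\<pi>) = g (p \<circ> (\<lambda>\<gamma>. \<gamma> + k))"
        using g(1) unfolding tame_def by (simp add: block_swap_def)
      moreover have "ren ?\<pi> (g (p \<circ> ?\<pi>)) = ren (\<lambda>\<gamma>. \<gamma> + k) (g (p \<circ> ?\<pi>))"
        using g(1) by (intro ren_cong) (auto simp: tame_def block_swap_def)
      ultimately show ?thesis by (simp add: relabel_ren)
    qed
    moreover have "ren ?\<pi> (ren (\<lambda>\<gamma>. \<gamma> + l) (f (p \<circ> ?\<pi> \<circ> (\<lambda>\<gamma>. \<gamma> + l)))) = f p"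
    proof -
      have "f (p \<circ> ?\<pi> \<circ> (\<lambda>\<gamma>. \<gamma> + l)) = f p"
        using f(1) unfolding tame_def by (simp add: block_swap_def)
      moreover have "ren (?\<pi> \<circ> (\<lambda>\<gamma>. \<gamma> + l)) (f p) = ren id (f p)"
        using f(1) by (intro ren_cong) (auto simp: tame_def block_swap_def)
      ultimately show ?thesis by (simp add: ren_ren ren_id)
    qed
    ultimately have "relabel ?\<pi> (dens_times l g f) p = cyc_times (?G p) (f p)"
      by (simp add: relabel_ren dens_times_def ren_cyc_times)
    then show "dens_times k f g p
        = scl ((-1) ^ (d * e)) (relabel ?\<pi> (dens_times l g f) p) + (?z p - rot (?z p))"
      using Z[OF f(2)[THEN spec] e] by (simp add: dens_times_def)
  qed
qed

text \<open>
  Both sides identify exactly \<open>\<alpha>\<close> and \<open>\<beta>\<close>, so they differ by a bijection of the values. Explicitly, a copy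
  that remains after removing \<open>\<beta>\<close> is lifted to its original number, permuted, and renumbered after
  removing \<open>\<pi> \<beta>\<close>.
\<close>

lemma merge_permutes:
  assumes \<pi>: "\<pi> permutes {..<N}" and "\<alpha> < N" "\<beta> < N" "\<alpha> \<noteq> \<beta>"
  obtains \<rho> where "\<rho> permutes {..<N - 1}" "merge (\<pi> \<alpha>) (\<pi> \<beta>) \<circ> \<pi> = \<rho> \<circ> merge \<alpha> \<beta>"
proof -
  \<comment> \<open>\<open>squeeze \<beta>\<close> closes the gap left by \<open>\<beta>\<close>, and \<open>skip \<beta>\<close> opens it.\<close>
  define squeeze where "squeeze \<beta> \<delta> = (if \<delta> > \<beta> then \<delta> - 1 else \<delta>)" for \<beta> \<delta> :: nat
  define skip where "skip \<beta> \<delta> = (if \<delta> < \<beta> then \<delta> else \<delta> + 1)" for \<beta> \<delta> :: nat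
  have ds: "squeeze \<beta> (skip \<beta> \<delta>) = \<delta>" "skip \<beta> \<delta> \<noteq> \<beta>" "\<delta> \<noteq> \<beta> \<Longrightarrow> skip \<beta> (squeeze \<beta> \<delta>) = \<delta>" for \<beta> \<delta>
    by (auto simp: squeeze_def skip_def)
  have mg: "merge \<alpha> \<beta> \<gamma> = squeeze \<beta> (if \<gamma> = \<beta> then \<alpha> else \<gamma>)" for \<alpha> \<beta> \<gamma>
    by (simp add: merge_def squeeze_def Let_def)
  have inj: "\<pi> x = \<pi> y \<longleftrightarrow> x = y" for x y using permutes_inj[OF \<pi>] by (auto dest: injD)
  define \<rho> where "\<rho> \<delta> = squeeze (\<pi> \<beta>) (\<pi> (skip \<beta> \<delta>))" for \<delta>
  define \<rho>' where "\<rho>' \<delta> = squeeze \<beta> (inv \<pi> (skip (\<pi> \<beta>) \<delta>))" for \<delta>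
  have "\<rho>' (\<rho> \<delta>) = \<delta>" for \<delta>
    by (simp add: \<rho>_def \<rho>'_def ds inj permutes_inverses[OF \<pi>])
  moreover have "\<rho> (\<rho>' \<delta>) = \<delta>" for \<delta>
  proof -
    have "inv \<pi> (skip (\<pi> \<beta>) \<delta>) \<noteq> \<beta>" using ds(2) permutes_inverses[OF \<pi>] by metis
    then show ?thesis by (simp add: \<rho>_def \<rho>'_def ds permutes_inverses[OF \<pi>])
  qed
  moreover have "\<rho> \<delta> = \<delta>" if "\<delta> \<notin> {..<N - 1}" for \<delta>
  proof -
    have "\<pi> \<beta> < N" using permutes_in_image[OF \<pi>, of \<beta>] assms(3) by simp
    moreover have "\<pi> (\<delta> + 1) = \<delta> + 1" using that by (intro permutes_not_in[OF \<pi>]) auto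
    ultimately show ?thesis using that assms(3) by (auto simp: \<rho>_def skip_def squeeze_def)
  qed
  ultimately have "\<rho> permutes {..<N - 1}" unfolding permutes_def by metis
  moreover have "merge (\<pi> \<alpha>) (\<pi> \<beta>) \<circ> \<pi> = \<rho> \<circ> merge \<alpha> \<beta>"
    using \<open>\<alpha> \<noteq> \<beta>\<close> by (auto simp: mg \<rho>_def ds inj)
  ultimately show ?thesis by (rule that)
qed

definition diagonal_term ::
  "('c, 'x, 'n::finite) mfd \<Rightarrow> nat \<Rightarrow> nat \<Rightarrow> ('c, 'x, 'm::finite, 'n) dens \<Rightarrow> ('c, 'x, 'm, 'n) dens" where
  "diagonal_term M \<alpha> \<beta> h = relabel (merge \<alpha> \<beta>) (laplace_term M \<alpha> \<beta> h)"

text \<open>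
  The exchange of factors at the level of one pair of copies. The correction term of
  \<open>dens_times_swap\<close> stays a sum of differences of rotations under the Laplacian and under the
  restriction to the diagonal.
\<close>

lemma diagonal_term_swap:
  assumes M: "affine_manifold M"
    and f: "tame M k f" "\<forall>p. \<forall>w\<in>Poly_Mapping.keys (f p). wdeg w = d"
    and g: "tame M l g" "\<forall>p. \<forall>w\<in>Poly_Mapping.keys (g p). wdeg w = e"
    and ab: "\<alpha> < k + l" "\<beta> < k + l" "\<alpha> \<noteq> \<beta>"
  obtains \<rho> where "\<rho> permutes {..<k + l - 1}"
    "\<And>p. p \<in> configs M \<Longrightarrow>
      diagonal_term M (block_swap l k \<alpha>) (block_swap l k \<beta>) (dens_times k f g) p
      - scl ((-1) ^ (d * e)) (relabel \<rho> (diagonal_term M \<alpha> \<beta> (dens_times l g f)) p) \<in> cyc_null"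
proof -
  let ?\<pi> = "block_swap l k" and ?s = "(-1) ^ (d * e) :: real"
  let ?fg = "dens_times k f g" and ?gf = "dens_times l g f" and ?m = "merge (block_swap l k \<alpha>) (block_swap l k \<beta>)"
  obtain \<rho> where \<rho>: "\<rho> permutes {..<k + l - 1}" "?m \<circ> ?\<pi> = \<rho> \<circ> merge \<alpha> \<beta>"
    by (rule merge_permutes[OF block_swap_permutes ab])
  obtain z where z: "regular M z" "\<And>p. ?fg p = scl ?s (relabel ?\<pi> ?gf p) + (z p - rot (z p))"
    by (rule dens_times_swap[OF f g]) (rule that)
  have reg: "regular M ?gf" using f(1) g(1) by (auto simp: tame_def intro: regular_dens_times)
  have "inj ?\<pi>" by (rule permutes_inj[OF block_swap_permutes])
  show ?thesis
  proof (rule that[OF \<rho>(1)])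
    fix p assume p: "p \<in> configs M"
    then have q: "p \<circ> ?m \<in> configs M" by (rule configs_comp)
    let ?c = "laplace_term M (?\<pi> \<alpha>) (?\<pi> \<beta>) (\<lambda>q. z q - rot (z q)) (p \<circ> ?m)"
    have "?fg = (\<lambda>q. scl ?s (relabel ?\<pi> ?gf q) + (z q - rot (z q)))" using z(2) by blast
    then have "laplace_term M (?\<pi> \<alpha>) (?\<pi> \<beta>) ?fg (p \<circ> ?m)
      = laplace_term M (?\<pi> \<alpha>) (?\<pi> \<beta>) (\<lambda>q. scl ?s (relabel ?\<pi> ?gf q)) (p \<circ> ?m) + ?c"
      using laplace_term_add[OF M regular_lin_op_id[OF regular_relabel[OF reg] lin_op_scl]
        regular_lin_op_id[OF z(1) lin_op_diff_op[OF lin_op_id lin_op_rot]] q] by simp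
    also have "laplace_term M (?\<pi> \<alpha>) (?\<pi> \<beta>) (\<lambda>q. scl ?s (relabel ?\<pi> ?gf q)) (p \<circ> ?m)
      = scl ?s (relabel ?\<pi> (laplace_term M \<alpha> \<beta> ?gf) (p \<circ> ?m))"
      by (simp add: laplace_term_scl[OF M regular_relabel[OF reg] q]
          laplace_term_relabel[OF M \<open>inj ?\<pi>\<close> reg q])
    finally have lt: "laplace_term M (?\<pi> \<alpha>) (?\<pi> \<beta>) ?fg (p \<circ> ?m)
      = scl ?s (relabel ?\<pi> (laplace_term M \<alpha> \<beta> ?gf) (p \<circ> ?m)) + ?c" .
    have "diagonal_term M (?\<pi> \<alpha>) (?\<pi> \<beta>) ?fg p
      = scl ?s (relabel ?m (relabel ?\<pi> (laplace_term M \<alpha> \<beta> ?gf)) p) + ren ?m ?c"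
      unfolding diagonal_term_def relabel_ren[of ?m] lt
      by (simp only: lin_op_add[OF lin_op_ren] lin_op_scale[OF lin_op_ren])
    also have "relabel ?m (relabel ?\<pi> (laplace_term M \<alpha> \<beta> ?gf))
      = relabel \<rho> (diagonal_term M \<alpha> \<beta> ?gf)"
      by (simp add: diagonal_term_def relabel_relabel \<rho>(2))
    finally show "diagonal_term M (?\<pi> \<alpha>) (?\<pi> \<beta>) ?fg p - scl ?s (relabel \<rho> (diagonal_term M \<alpha> \<beta> ?gf) p) \<in> cyc_null"
      by (simp only: add_diff_cancel_left' ren_cyc_null[OF laplace_term_cyc_null[OF M z(1) q]])
  qed
qed

section \<open>Densities of local functionals\<close>

lemma sum_fun_apply: "(\<Sum>i\<in>S. f i) x = (\<Sum>i\<in>S. f i x)"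
  by (induction S rule: infinite_finite_induct) simp_all

lemma tame_pre_density:
  assumes "pre_density M L h" shows "tame M L h"
proof -
  obtain W where W: "finite W" "\<forall>w\<in>W. \<forall>l\<in>set w. fst l < L" "\<forall>p. Poly_Mapping.keys (h p) \<subseteq> W"
    and c: "\<And>w. (\<lambda>p. Poly_Mapping.lookup (h p) w) \<in> multi_coeffs M L"
    using assms unfolding pre_density_def by blast
  have "regular M h"
    by (rule regularI[OF W(1)]) (use W(3) c multi_coeffs_subset in blast)+
  moreover have "h p = h p'" if "\<forall>i<L. p i = p' i" for p p'
  proof (rule poly_mapping_eqI)
    fix w
    obtain N r e where "(\<lambda>p. Poly_Mapping.lookup (h p) w) = (\<lambda>p. \<Sum>s<(N::nat). r s * (\<Prod>i<L. e s i (p i)))"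
      using c[of w] unfolding multi_coeffs_def by blast
    then show "Poly_Mapping.lookup (h p) w = Poly_Mapping.lookup (h p') w"
      using that by (simp add: fun_eq_iff)
  qed
  ultimately show ?thesis using W(2,3) unfolding tame_def by blast
qed

lemma tame_zero: "tame M L 0"
  using regular_zero by (simp add: tame_def zero_fun_def)

lemma tameI:
  assumes "regular M h" "\<And>p w x. w \<in> Poly_Mapping.keys (h p) \<Longrightarrow> x \<in> set w \<Longrightarrow> fst x < L"
    and "\<And>p p'. (\<And>i. i < L \<Longrightarrow> p i = p' i) \<Longrightarrow> h p = h p'"
  shows "tame M L h"
  unfolding tame_def using assms(1,2) by (auto intro: assms(3))

lemma tameD:
  assumes "tame M L h"
  shows "regular M h" "w \<in> Poly_Mapping.keys (h p) \<Longrightarrow> x \<in> set w \<Longrightarrow> fst x < L"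
    and "(\<And>i. i < L \<Longrightarrow> p i = p' i) \<Longrightarrow> h p = h p'"
  using assms unfolding tame_def by auto

lemma tame_add:
  assumes "tame M L h" "tame M L h'" shows "tame M L (h + h')"
  unfolding plus_fun_def
proof (rule tameI)
  show "regular M (\<lambda>p. h p + h' p)" by (rule regular_add[OF tameD(1)[OF assms(1)] tameD(1)[OF assms(2)]])
  show "fst x < L" if "w \<in> Poly_Mapping.keys (h p + h' p)" "x \<in> set w" for p w x
    using subsetD[OF keys_add that(1)] tameD(2)[OF assms(1) _ that(2)] tameD(2)[OF assms(2) _ that(2)]
    by blast
  show "h p + h' p = h p' + h' p'" if "\<And>i. i < L \<Longrightarrow> p i = p' i" for p p'
    using tameD(3)[OF assms(1) that] tameD(3)[OF assms(2) that] by simp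
qed

lemma tame_sum: "(\<And>i. i \<in> S \<Longrightarrow> tame M L (h i)) \<Longrightarrow> tame M L (\<Sum>i\<in>S. h i)"
  by (induction S rule: infinite_finite_induct) (auto intro: tame_add tame_zero)

lemma tame_scl:
  assumes "tame M L h" shows "tame M L (\<lambda>p. scl r (h p))"
proof (rule tameI)
  show "regular M (\<lambda>p. scl r (h p))" by (rule regular_lin_op_id[OF tameD(1)[OF assms] lin_op_scl])
  show "fst x < L" if "w \<in> Poly_Mapping.keys (scl r (h p))" "x \<in> set w" for p w x
    by (rule tameD(2)[where p = p, OF assms _ that(2)]) (use that(1) in \<open>simp add: in_keys_iff\<close>)
  show "scl r (h p) = scl r (h p')" if "\<And>i. i < L \<Longrightarrow> p i = p' i" for p p'
    using tameD(3)[OF assms that] by simp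
qed

lemma tame_dens_times:
  assumes f: "tame M k f" and g: "tame M l g"
  shows "tame M (k + l) (dens_times k f g)"
proof -
  have "fst x < k + l" if w: "w \<in> Poly_Mapping.keys (dens_times k f g p)" "x \<in> set w" for p w x
  proof -
    let ?G = "relabel (\<lambda>\<gamma>. \<gamma> + k) g p"
    from w(1) have "(\<Sum>u\<in>Poly_Mapping.keys (f p). \<Sum>v\<in>Poly_Mapping.keys ?G.
      Poly_Mapping.lookup (f p) u * Poly_Mapping.lookup ?G v * Poly_Mapping.lookup (word_times u v) w) \<noteq> 0"
      by (simp add: in_keys_iff dens_times_def cyc_times_def lookup_sum
          bilin_ext_over[OF finite_keys subset_refl finite_keys subset_refl])
    then obtain u v where uv: "u \<in> Poly_Mapping.keys (f p)" "v \<in> Poly_Mapping.keys ?G"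
      "Poly_Mapping.lookup (word_times u v) w \<noteq> 0"
      by (metis (no_types, lifting) sum.neutral mult_zero_right)
    then have "set w \<subseteq> set u \<union> set v" by (intro set_word_times) (simp add: in_keys_iff)
    with w(2) consider "x \<in> set u" | "x \<in> set v" by blast
    then show ?thesis
    proof cases
      case 1
      then show ?thesis using tameD(2)[OF f uv(1)] by (simp add: trans_less_add1)
    next
      case 2
      obtain v' where v': "v' \<in> Poly_Mapping.keys (g (p \<circ> (\<lambda>\<gamma>. \<gamma> + k)))"
        "v = map (map_prod (\<lambda>\<gamma>. \<gamma> + k) id) v'"
        using subsetD[OF keys_lin_op[OF lin_op_ren] uv(2)[unfolded relabel_ren]] by auto
      with 2 obtain y where y: "y \<in> set v'" "x = map_prod (\<lambda>\<gamma>. \<gamma> + k) id y" by auto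
      then show ?thesis using tameD(2)[OF g v'(1) y(1)] by simp
    qed
  qed
  moreover have "dens_times k f g p = dens_times k f g p'" if "\<And>i. i < k + l \<Longrightarrow> p i = p' i" for p p'
  proof -
    have "f p = f p'" by (rule tameD(3)[OF f]) (simp add: that)
    moreover have "g (p \<circ> (\<lambda>\<gamma>. \<gamma> + k)) = g (p' \<circ> (\<lambda>\<gamma>. \<gamma> + k))"
      by (rule tameD(3)[OF g]) (simp add: that)
    ultimately show ?thesis by (simp only: dens_times_def relabel_ren)
  qed
  ultimately show ?thesis
    by (rule tameI[OF regular_dens_times[OF tameD(1)[OF f] tameD(1)[OF g]]])
qed

lemma dens_times_zero: "dens_times k 0 g = 0" "dens_times k f 0 = 0"
  by (auto simp: fun_eq_iff dens_times_def relabel_ren lin_op_zero[OF lin_op_cyc_times(1)]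
      lin_op_zero[OF lin_op_cyc_times(2)] lin_op_zero[OF lin_op_ren])

lemma tame_over:
  assumes "tame M N h" shows "(\<forall>L. tame M L (over N h L)) \<and> (\<exists>B. \<forall>L>B. over N h L = 0)"
proof (intro conjI exI[of _ N])
  show "\<forall>L. tame M L (over N h L)" using assms by (simp add: over_def tame_zero del: zero_fun_apply)
  show "\<forall>L>N. over N h L = 0" by (simp add: over_def del: zero_fun_apply)
qed

text \<open>
  A local functional has finitely many components. The exchange of the numbers of copies happens in one
  component at a time, and null functionals are closed under finite sums only.
\<close>

lemma local_functionals_tame:
  assumes "F \<in> local_functionals M"
  shows "(\<forall>L. tame M L (F L)) \<and> (\<exists>B. \<forall>L>B. F L = 0)"
  using assms
proof (induction rule: local_functionals.induct)
  case (number r)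
  have "tame M 0 (\<lambda>p. Poly_Mapping.single [] r)"
    unfolding tame_def
    by (auto intro!: regularI[of "{[]}"] smooth_coeffs.const simp: lookup_single)
  then show ?case by (rule tame_over)
next
  case (integral f)
  then have "tame M 1 f" by (intro tame_pre_density) (simp add: density_def)
  then show ?case by (rule tame_over)
next
  case (times F G)
  then obtain B B' where B: "\<forall>L>B. F L = 0" "\<forall>L>B'. G L = 0" by blast
  have "tame M L (ftimes F G L)" for L
    unfolding ftimes_def
  proof (rule tame_sum)
    fix k assume "k \<in> {..L}"
    then show "tame M L (dens_times k (F k) (G (L - k)))"
      using tame_dens_times[of M k "F k" "L - k" "G (L - k)"] times.IH by simp
  qed
  moreover have "ftimes F G L = 0" if "L > B + B'" for L
    unfolding ftimes_def
  proof (rule sum.neutral, rule ballI)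
    fix k assume "k \<in> {..L}"
    with that have "k > B \<or> L - k > B'" by auto
    with B show "dens_times k (F k) (G (L - k)) = 0" by (auto simp: dens_times_zero)
  qed
  ultimately show ?case by blast
next
  case (plus F G)
  then obtain B B' where "\<forall>L>B. F L = 0" "\<forall>L>B'. G L = 0" by blast
  then have "\<forall>L>max B B'. (F + G) L = 0" by simp
  moreover have "\<forall>L. tame M L ((F + G) L)" using plus.IH by (simp only: plus_fun_apply tame_add simp_thms)
  ultimately show ?case by blast
next
  case (scale F r)
  then obtain B where "\<forall>L>B. F L = 0" by blast
  then have "\<forall>L>B. fscl r F L = 0" by (simp add: fscl_def zero_fun_def)
  moreover have "\<forall>L. tame M L (fscl r F L)" using scale.IH by (simp only: fscl_def tame_scl simp_thms)
  ultimately show ?case by blast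
qed

section \<open>The part of the Laplacian connecting the two factors\<close>

definition cross :: "nat \<Rightarrow> nat \<Rightarrow> (nat \<times> nat) set" where
  "cross k l = {..<k} \<times> {k..<k + l} \<union> {k..<k + l} \<times> {..<k}"

text \<open>
  The bound \<open>B\<close> is meant to bound the number of copies in every nonzero component of \<open>F\<close> and \<open>G\<close>.
\<close>

definition cross_laplace ::
  "('c, 'x, 'n::finite) mfd \<Rightarrow> nat \<Rightarrow> ('c, 'x, 'm::finite, 'n) functional \<Rightarrow>
    ('c, 'x, 'm, 'n) functional \<Rightarrow> ('c, 'x, 'm, 'n) functional" where
  "cross_laplace M B F G = (\<Sum>k\<le>B. \<Sum>l\<le>B.
     laplace_on M (cross k l) (k + l) (dens_times k (F k) (G l)))"

lemma laplace_on_split: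
  "laplace_on M ({..<k + l} \<times> {..<k + l}) (k + l) h = laplace_on M ({..<k} \<times> {..<k}) (k + l) h
    + laplace_on M ({k..<k + l} \<times> {k..<k + l}) (k + l) h + laplace_on M (cross k l) (k + l) h"
proof -
  have *: "{..<k + l} \<times> {..<k + l} = ({..<k} \<times> {..<k} \<union> {k..<k + l} \<times> {k..<k + l}) \<union> cross k l"
    by (auto simp: cross_def)
  have "({..<k} \<times> {..<k} \<union> {k..<k + l} \<times> {k..<k + l}) \<inter> cross k l = {}"
    "({..<k} \<times> {..<k}) \<inter> ({k..<k + l} \<times> {k..<k + l}) = {}" by (auto simp: cross_def)
  moreover have "finite (cross k l)" by (simp add: cross_def)
  ultimately show ?thesis
    unfolding laplace_on_def * by (simp add: sum.union_disjoint)
qed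

lemma laplace_on_apply:
  "laplace_on M S N h j p = (\<Sum>(\<alpha>, \<beta>)\<in>S.
     if \<alpha> = \<beta> then (if j = N then laplace_term M \<alpha> \<beta> h p else 0)
     else (if j = N - 1 then ren (merge \<alpha> \<beta>) (laplace_term M \<alpha> \<beta> h (p \<circ> merge \<alpha> \<beta>)) else 0))"
  unfolding laplace_on_def sum_fun_apply
  by (rule sum.cong) (auto simp: over_def relabel_ren)

lemma laplace_on_far: "N > Suc j \<Longrightarrow> laplace_on M S N h j = 0"
  by (rule ext) (auto simp: laplace_on_apply intro!: sum.neutral)

lemma laplace_on_zero: "laplace_on M S N 0 = 0"
  by (intro ext) (auto simp: laplace_on_apply zero_fun_def laplace_term_zero lin_op_zero[OF lin_op_ren]
      intro!: sum.neutral)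

lemma laplace_on_sum:
  assumes M: "affine_manifold M" and p: "p \<in> configs M" and h: "\<And>i. i \<in> I \<Longrightarrow> regular M (h i)"
  shows "laplace_on M S N (\<lambda>q. \<Sum>i\<in>I. h i q) j p = (\<Sum>i\<in>I. laplace_on M S N (h i) j p)"
  unfolding laplace_on_apply
  by (subst sum.swap, rule sum.cong)
     (auto simp: laplace_term_sum[OF M _ h] p configs_comp lin_op_sum[OF lin_op_ren])

text \<open>
  Up to its sign, the bracket is the connecting part of the Laplacian: pairs of copies within one
  factor cancel. What remains over \<open>j\<close> copies comes from products over \<open>j + 1\<close> copies with nonzero
  factors, and all ranges of summation contain these.
\<close>

lemma laplace_cross:
  assumes M: "affine_manifold M" and p: "p \<in> configs M"
    and F: "\<And>L. tame M L (F L)" "\<And>L. L > B \<Longrightarrow> F L = 0"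
    and G: "\<And>L. tame M L (G L)" "\<And>L. L > B \<Longrightarrow> G L = 0"
  shows "(laplace M (ftimes F G) - laplace_left M F G - laplace_right M F G) j p = cross_laplace M B F G j p"
proof -
  let ?h = "\<lambda>k l. dens_times k (F k) (G l)"
  let ?T = "{(k, l). k + l \<le> Suc j}" and ?Q = "{..Suc j} \<times> {..Suc j}"
  have reg: "regular M (?h k l)" for k l
    using F(1) G(1) by (auto simp: tame_def intro: regular_dens_times)
  have T: "?T \<subseteq> ?Q" by auto
  then have fT: "finite ?T" by (rule finite_subset) simp
  have far: "laplace_on M S (k + l) h j p = 0" if "(k, l) \<notin> ?T" for S k l h
    using that by (simp add: laplace_on_far)
  have "laplace M (ftimes F G) j p
      = (\<Sum>L\<le>Suc j. \<Sum>k\<le>L. laplace_on M ({..<k + (L - k)} \<times> {..<k + (L - k)}) (k + (L - k)) (?h k (L - k)) j p)"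
    unfolding laplace_def ftimes_def sum_fun_apply
    by (rule sum.cong[OF refl], subst laplace_on_sum[OF M p reg], rule sum.cong[OF refl]) simp
  also have "\<dots> = (\<Sum>(k, l)\<in>?T. laplace_on M ({..<k + l} \<times> {..<k + l}) (k + l) (?h k l) j p)"
    by (rule sum.triangle_reindex_eq[symmetric])
  finally have 1: "laplace M (ftimes F G) j p = \<dots>" .
  have sq: "(\<Sum>k\<le>Suc j. \<Sum>l\<le>Suc j. laplace_on M (S k l) (k + l) (?h k l) j p)
      = (\<Sum>(k, l)\<in>?T. laplace_on M (S k l) (k + l) (?h k l) j p)" for S
    unfolding sum.cartesian_product
  proof (rule sum.mono_neutral_right[OF _ T])
    show "\<forall>x\<in>?Q - ?T. (case x of (k, l) \<Rightarrow> laplace_on M (S k l) (k + l) (?h k l) j p) = 0"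
    proof
      fix x assume "x \<in> ?Q - ?T"
      then show "(case x of (k, l) \<Rightarrow> laplace_on M (S k l) (k + l) (?h k l) j p) = 0"
        by (cases x) (simp add: far)
    qed
  qed simp
  have 2: "laplace_left M F G j p = (\<Sum>(k, l)\<in>?T. laplace_on M ({..<k} \<times> {..<k}) (k + l) (?h k l) j p)"
    unfolding laplace_left_def sum_fun_apply by (rule sq)
  have 3: "laplace_right M F G j p
      = (\<Sum>(k, l)\<in>?T. laplace_on M ({k..<k + l} \<times> {k..<k + l}) (k + l) (?h k l) j p)"
    unfolding laplace_right_def sum_fun_apply by (rule sq)
  have "(laplace M (ftimes F G) - laplace_left M F G - laplace_right M F G) j p
      = (\<Sum>(k, l)\<in>?T. laplace_on M (cross k l) (k + l) (?h k l) j p)"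
    unfolding fun_diff_def 1 2 3 sum_subtractf[symmetric]
    by (rule sum.cong) (auto simp: laplace_on_split)
  also have "\<dots> = (\<Sum>(k, l)\<in>{..B} \<times> {..B}. laplace_on M (cross k l) (k + l) (?h k l) j p)"
  proof (rule sum.mono_neutral_cong)
    show "(case x of (k, l) \<Rightarrow> laplace_on M (cross k l) (k + l) (?h k l) j p) = 0"
      if "x \<in> ?T - {..B} \<times> {..B}" for x
    proof -
      obtain k l where x: "x = (k, l)" by (cases x)
      with that have "k > B \<or> l > B" by auto
      then have "?h k l = 0" using F(2) G(2) by (auto simp only: dens_times_zero)
      then show ?thesis by (simp only: x prod.case laplace_on_zero zero_fun_apply)
    qed
    show "(case x of (k, l) \<Rightarrow> laplace_on M (cross k l) (k + l) (?h k l) j p) = 0"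
      if "x \<in> {..B} \<times> {..B} - ?T" for x
      using that by (cases x) (simp add: far)
  qed (auto simp: fT)
  finally show ?thesis
    unfolding cross_laplace_def sum_fun_apply by (simp only: sum.cartesian_product)
qed

section \<open>Skew-symmetry of the bracket\<close>

lemma null_zero: "0 \<in> null_functionals M"
  by (rule null_functionals.cyclic) (simp add: cyc_null_zero)

lemma null_sum: "(\<And>i. i \<in> S \<Longrightarrow> f i \<in> null_functionals M) \<Longrightarrow> sum f S \<in> null_functionals M"
  by (induction S rule: infinite_finite_induct) (auto intro: null_zero null_functionals.plus)

lemma fscl_linear: "fscl a (F + G) = fscl a F + fscl a G" "fscl a 0 = 0" "fscl a (fscl b F) = fscl (a * b) F"
  by (simp_all add: fscl_def fun_eq_iff scl_distribs)

lemma fscl_sum: "fscl a (sum F S) = (\<Sum>i\<in>S. fscl a (F i))"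
  by (induction S rule: infinite_finite_induct)
     (simp_all only: fscl_linear sum.infinite sum.empty sum.insert not_False_eq_True)

text \<open>
  Let \<open>P\<close> and \<open>Q\<close> be the densities of the two terms, so that \<open>P\<close> is cyclically equivalent to
  \<open>relabel \<rho> Q\<close> up to sign. Then \<open>a P - b Q\<close> is \<open>h - relabel \<rho> h\<close> for \<open>h = - b Q\<close>, plus a cyclic null
  density.
\<close>

lemma diagonal_term_null:
  assumes M: "affine_manifold M"
    and f: "tame M k f" "\<forall>p. \<forall>w\<in>Poly_Mapping.keys (f p). wdeg w = d"
    and g: "tame M l g" "\<forall>p. \<forall>w\<in>Poly_Mapping.keys (g p). wdeg w = e"
    and ab: "\<alpha> < k + l" "\<beta> < k + l" "\<alpha> \<noteq> \<beta>" and b: "b = a * (-1) ^ (d * e)"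
  shows "fscl a (over (k + l - 1) (diagonal_term M (block_swap l k \<alpha>) (block_swap l k \<beta>) (dens_times k f g)))
    - fscl b (over (k + l - 1) (diagonal_term M \<alpha> \<beta> (dens_times l g f))) \<in> null_functionals M"
    (is "fscl a (over ?N ?fg) - fscl b (over ?N ?gf) \<in> _")
proof -
  let ?s = "(-1) ^ (d * e) :: real"
  obtain \<rho> where \<rho>: "\<rho> permutes {..<?N}"
    "\<And>p. p \<in> configs M \<Longrightarrow> ?fg p - scl ?s (relabel \<rho> ?gf p) \<in> cyc_null"
    by (rule diagonal_term_swap[OF M f g ab]) (rule that)
  \<comment> \<open>Since \<open>b = a ?s\<close>, the relabelled copies of \<open>?gf\<close> in \<open>?h - relabel \<rho> ?h\<close> and in \<open>?r\<close> cancel.\<close>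
  let ?h = "\<lambda>p. scl (- b) (?gf p)"
  let ?r = "\<lambda>p. scl a (?fg p - scl ?s (relabel \<rho> ?gf p))"
  have "over ?N (?h - relabel \<rho> ?h) + over ?N ?r \<in> null_functionals M"
    using \<rho> by (intro null_functionals.plus null_functionals.rename null_functionals.cyclic)
      (auto simp: over_def cyc_null_zero intro: cyc_null_scl)
  also have "over ?N (?h - relabel \<rho> ?h) + over ?N ?r = fscl a (over ?N ?fg) - fscl b (over ?N ?gf)"
    by (auto simp: fun_eq_iff over_def fscl_def relabel_ren lin_op_scale[OF lin_op_ren] scl_distribs
        b lin_op_minus[OF lin_op_ren])
  finally show ?thesis .
qed

lemma laplace_on_cross:
  "laplace_on M (cross k l) N h = (\<Sum>(\<alpha>, \<beta>)\<in>cross k l. over (N - 1) (diagonal_term M \<alpha> \<beta> h))"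
  unfolding laplace_on_def diagonal_term_def by (rule sum.cong) (auto simp: cross_def)

lemma bij_betw_cross:
  "bij_betw (map_prod (block_swap l k) (block_swap l k)) (cross l k) (cross k l)"
  by (rule bij_betw_byWitness[where f' = "map_prod (block_swap k l) (block_swap k l)"])
     (auto simp: cross_def block_swap_def)

lemma sum_cross_swap:
  "(\<Sum>(\<alpha>, \<beta>)\<in>cross k l. f \<alpha> \<beta>)
    = (\<Sum>(\<alpha>, \<beta>)\<in>cross l k. f (block_swap l k \<alpha>) (block_swap l k \<beta>))"
  using sum.reindex_bij_betw[OF bij_betw_cross, of "\<lambda>(\<alpha>, \<beta>). f \<alpha> \<beta>" l k]
  by (simp add: case_prod_unfold)

lemma cross_laplace_swap:
  assumes M: "affine_manifold M"
    and F: "\<And>L. tame M L (F L)" "homogeneous d F" and G: "\<And>L. tame M L (G L)" "homogeneous e G"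
    and b: "b = a * (-1) ^ (d * e)"
  shows "fscl a (cross_laplace M B F G) - fscl b (cross_laplace M B G F) \<in> null_functionals M"
proof -
  let ?D = "\<lambda>k l \<alpha> \<beta>. over (k + l - 1) (diagonal_term M \<alpha> \<beta> (dens_times k (F k) (G l)))"
  let ?E = "\<lambda>k l \<alpha> \<beta>. over (k + l - 1) (diagonal_term M \<alpha> \<beta> (dens_times l (G l) (F k)))"
  have FG: "cross_laplace M B F G = (\<Sum>k\<le>B. \<Sum>l\<le>B. \<Sum>(\<alpha>, \<beta>)\<in>cross l k.
      ?D k l (block_swap l k \<alpha>) (block_swap l k \<beta>))"
    unfolding cross_laplace_def laplace_on_cross by (intro sum.cong refl sum_cross_swap)
  have GF: "cross_laplace M B G F = (\<Sum>k\<le>B. \<Sum>l\<le>B. \<Sum>(\<alpha>, \<beta>)\<in>cross l k. ?E k l \<alpha> \<beta>)"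
    unfolding cross_laplace_def laplace_on_cross by (subst sum.swap) (simp only: add.commute)
  have "(\<Sum>k\<le>B. \<Sum>l\<le>B. \<Sum>(\<alpha>, \<beta>)\<in>cross l k.
      fscl a (?D k l (block_swap l k \<alpha>) (block_swap l k \<beta>)) - fscl b (?E k l \<alpha> \<beta>)) \<in> null_functionals M"
  proof (intro null_sum, clarify)
    fix k l \<alpha> \<beta> assume "(\<alpha>, \<beta>) \<in> cross l k"
    then have ab: "\<alpha> < k + l" "\<beta> < k + l" "\<alpha> \<noteq> \<beta>" by (auto simp: cross_def)
    show "fscl a (?D k l (block_swap l k \<alpha>) (block_swap l k \<beta>)) - fscl b (?E k l \<alpha> \<beta>) \<in> null_functionals M"
      using F(2) G(2) by (intro diagonal_term_null[OF M F(1) _ G(1) _ ab b]) (auto simp: homogeneous_def)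
  qed
  then show ?thesis
    by (simp add: FG GF fscl_sum sum_subtractf case_prod_unfold)
qed

lemma cross_laplace_zero: "cross_laplace M B 0 G = 0" "cross_laplace M B F 0 = 0"
  by (simp_all add: cross_laplace_def dens_times_zero laplace_on_zero)

lemma fdeg_homogeneous: "homogeneous d F \<Longrightarrow> homogeneous (fdeg F) F"
  unfolding fdeg_def by (rule someI)

text \<open>
  The degree of \<open>0\<close> is not unique, and \<open>fdeg\<close> picks an arbitrary one.
\<close>

lemma homogeneous_unique:
  assumes "homogeneous d F" "homogeneous d' F" "F \<noteq> 0" shows "d = d'"
proof -
  obtain L p where "F L p \<noteq> 0" using assms(3) by (auto simp: fun_eq_iff)
  then obtain w where "w \<in> Poly_Mapping.keys (F L p)" by (metis keys_eq_empty all_not_in_conv)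
  then show ?thesis using assms(1,2) unfolding homogeneous_def by metis
qed

lemma minus_one_powi: "(-1 :: real) powi n = (if even n then 1 else - 1)"
  by (simp add: power_int_minus_left_even power_int_minus_left_odd)

theorem corollary8:
  fixes M :: "('c, 'x::{t2_space, second_countable_topology}, 'n::finite) mfd"
    and F G :: "('c, 'x, 'm::finite, 'n) functional"
    and d e :: nat
  assumes "affine_manifold M"
    and "F \<in> local_functionals M" and "homogeneous d F"
    and "G \<in> local_functionals M" and "homogeneous e G"
  shows "feq M (schouten M F G)
    (fscl (- ((-1) powi ((int d - 1) * (int e - 1)))) (schouten M G F))"
proof -
  let ?c = "- ((-1) powi ((int d - 1) * (int e - 1))) :: real"
  obtain B where B: "\<And>L. L > B \<Longrightarrow> F L = 0" "\<And>L. L > B \<Longrightarrow> G L = 0"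
  proof -
    obtain B B' where "\<forall>L>B. F L = 0" "\<forall>L>B'. G L = 0"
      using local_functionals_tame[OF assms(2)] local_functionals_tame[OF assms(4)] by blast
    then show ?thesis by (intro that[of "max B B'"]) auto
  qed
  have tame: "tame M L (F L)" "tame M L (G L)" for L
    using local_functionals_tame[OF assms(2)] local_functionals_tame[OF assms(4)] by blast+
  let ?a = "(-1) ^ fdeg F :: real" and ?b = "?c * (-1) ^ fdeg G"
  let ?K = "fscl ?a (cross_laplace M B F G) - fscl ?b (cross_laplace M B G F)"
  have K: "?K \<in> null_functionals M"
  proof (cases "F = 0 \<or> G = 0")
    \<comment> \<open>The sign in the bracket is unrelated to \<open>d\<close> and \<open>e\<close> in this case, but there is nothing to compare.\<close>
    case True
    then show ?thesis
      by (auto simp: cross_laplace_zero fscl_linear null_zero)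
  next
    case False
    then have "fdeg F = d" "fdeg G = e"
      using homogeneous_unique assms(3,5) fdeg_homogeneous by blast+
    moreover have "?c * (-1) ^ e = (-1) ^ d * (-1) ^ (d * e)"
      by (simp add: minus_one_powi minus_one_power_iff)
    ultimately show ?thesis
      by (intro cross_laplace_swap[OF assms(1) tame(1) assms(3) tame(2) assms(5)]) simp
  qed
  have "schouten M F G - fscl ?c (schouten M G F) - ?K \<in> null_functionals M"
  proof (rule null_functionals.cyclic)
    fix j p assume p: "p \<in> configs M"
    show "(schouten M F G - fscl ?c (schouten M G F) - ?K) j p \<in> cyc_null"
      using laplace_cross[where j = j, OF assms(1) p tame(1) B(1) tame(2) B(2)]
        laplace_cross[where j = j, OF assms(1) p tame(2) B(2) tame(1) B(1)]
      by (simp add: schouten_def fscl_def cyc_null_zero)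
  qed
  from null_functionals.plus[OF this K] show ?thesis
    by (simp add: feq_def)
qed

end
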